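(* Let $\theta,\eta\in K_0(\operatorname{proj}\Lambda)_{\mathbb{R}}$. If $\eta\in\partial[\theta]_{\mathrm{TF}}\setminus[\theta]_{\mathrm{TF}}$, then $$\dim_{\mathbb{R}}\langle[\eta]_{\mathrm{TF}}\rangle_{\mathbb{R}}<\dim_{\mathbb{R}}\langle[\theta]_{\mathrm{TF}}\rangle_{\mathbb{R}}.$$
   Context: Setup: $k$ is an algebraically closed field and $\Lambda=kQ/I$ is a basic finite-dimensional $k$-algebra, $(Q,I)$ a bound quiver with $Q$ connected and $n$ vertices; $S_{(1)},\dots,S_{(n)}$ are the simple modules and $P_{(i)}$ is the projective cover of $S_{(i)}$. $\operatorname{mod}\Lambda$ is the category of finitely generated $\Lambda$-modules and $\operatorname{proj}\Lambda$ that of finitely generated projective ones. $K_0(\operatorname{mod}\Lambda)$ and $K_0(\operatorname{proj}\Lambda)$ are free abelian with bases $[S_{(i)}]$ and $[P_{(i)}]$; after tensoring with $\mathbb{R}$ both are identified with $\mathbb{R}^n$ via these bases, and $\langle\theta,x\rangle$ ($\theta\in K_0(\operatorname{proj}\Lambda)_{\mathbb{R}}$, $x\in K_0(\operatorname{mod}\Lambda)_{\mathbb{R}}$) is the bilinear pairing with $\langle[P_{(i)}],[S_{(j)}]\rangle=\delta_{ij}$. TF-equivalence: for $\theta\in K_0(\operatorname{proj}\Lambda)_{\mathbb{R}}$ let $\overline{\mathcal{T}}_\theta$ be the class of $M\in\operatorname{mod}\Lambda$ with $\langle\theta,[M']\rangle\ge0$ for every factor module $M'$ of $M$, and $\overline{\mathcal{F}}_\theta$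 the class of $M$ with $\langle\theta,[M']\rangle\le0$ for every submodule $M'$ of $M$. $\theta,\eta$ are TF-equivalent if $\overline{\mathcal{T}}_\theta=\overline{\mathcal{T}}_\eta$ and $\overline{\mathcal{F}}_\theta=\overline{\mathcal{F}}_\eta$; $[\theta]_{\mathrm{TF}}$ is the equivalence class of $\theta$ in $K_0(\operatorname{proj}\Lambda)_{\mathbb{R}}$. For a subset $\mathcal{X}$, $\langle\mathcal{X}\rangle_{\mathbb{R}}$ is its real linear span, $\mathcal{X}^\circ$ is the interior of $\mathcal{X}$ relative to $\langle\mathcal{X}\rangle_{\mathbb{R}}$, $\overline{\mathcal{X}}$ is the closure, and $\partial\mathcal{X}=\overline{\mathcal{X}}\setminus\mathcal{X}^\circ$. *)

theory Defs
  imports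
    "HOL-Analysis.Analysis"
    "HOL-Computational_Algebra.Polynomial"
    "HOL-Algebra.Module"
    "HOL-Algebra.QuotRing"
    "HOL-Algebra.Free_Abelian_Groups"
    "Graph_Theory.Digraph_Component"
begin

section \<open>Bound quiver algebras\<close>

text \<open>
  A quiver is a finite directed multigraph, possibly with loops; \<^term>\<open>tail Q a\<close> is the source of the arrow \<open>a\<close> and
  \<^term>\<open>head Q a\<close> is its target.  A path is a pair \<open>(u, p)\<close> of its starting vertex and its list of
  arrows in the order of traversal, so \<open>(u, [])\<close> is the trivial path at \<open>u\<close>.
\<close>

type_synonym ('v, 'a) path = "'v \<times> 'a list"

definition quiver_paths :: "('v, 'a) pre_digraph \<Rightarrow> ('v, 'a) path set" where
  "quiver_paths Q = {(u, p). \<exists>v. pre_digraph.awalk Q u p v}"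

text \<open>
  The path algebra \<open>kQ\<close>: an element is given by its coefficients with respect to the paths.
  Paths are composed like functions: \<open>q \<cdot> p\<close> is "first \<open>p\<close>, then \<open>q\<close>", so that left modules are
  the representations of \<open>Q\<close>.  The scalars \<open>k\<close> sit in \<open>kQ\<close> as the multiples of the unit, hence
  ideals of the ring \<open>kQ\<close> are subspaces, and modules over a quotient ring of \<open>kQ\<close>, as well as
  their homomorphisms, are automatically \<open>k\<close>-linear.
\<close>

definition path_algebra :: "('v, 'a) pre_digraph \<Rightarrow> (('v, 'a) path \<Rightarrow> 'k::field) ring" where
  "path_algebra Q =
    \<lparr> carrier = {f. finite {x. f x \<noteq> 0} \<and> {x. f x \<noteq> 0} \<subseteq> quiver_paths Q},
      monoid.mult = (\<lambda>f g (u, p). \<Sum>j\<le>length p.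
                f (last (pre_digraph.awalk_verts Q u (take j p)), drop j p) * g (u, take j p)),
      monoid.one = (\<lambda>(u, p). if u \<in> verts Q \<and> p = [] then 1 else 0),
      ring.zero = (\<lambda>_. 0),
      ring.add = (\<lambda>f g x. f x + g x) \<rparr>"

text \<open>
  The power \<open>R\<^sub>Q\<^sup>m\<close> of the arrow ideal \<open>R\<^sub>Q\<close>, i.e. the span of all paths of length at least \<open>m\<close>.
\<close>

definition arrow_ideal_pow :: "('v, 'a) pre_digraph \<Rightarrow> nat \<Rightarrow> (('v, 'a) path \<Rightarrow> 'k::field) set" where
  "arrow_ideal_pow Q m =
    {f \<in> carrier (path_algebra Q). \<forall>u p. f (u, p) \<noteq> 0 \<longrightarrow> m \<le> length p}"

text \<open>
  A connected quiver \<open>Q\<close> together with an admissible ideal \<open>I\<close> of \<open>kQ\<close>.  The vertex set is the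
  whole finite type \<open>'v\<close>, so the number \<open>n\<close> of vertices is \<open>CARD('v)\<close> and \<open>\<real>\<^sup>n\<close> is \<open>real ^ 'v\<close>;
  the arrows form an arbitrary, possibly empty, finite set.
\<close>

locale bound_quiver = fin_digraph Q
  for Q :: "('v::finite, 'a) pre_digraph" +
  fixes I :: "(('v, 'a) path \<Rightarrow> 'k::field) set"
  assumes verts_UNIV: "verts Q = UNIV"
    and connected: "Digraph_Component.connected Q"
    and ideal: "ideal I (path_algebra Q)"
    and admissible_lower: "\<exists>m\<ge>2. arrow_ideal_pow Q m \<subseteq> I"
    and admissible_upper: "I \<subseteq> arrow_ideal_pow Q 2"

abbreviation bound_quiver_algebra ::
    "('v, 'a) pre_digraph \<Rightarrow> (('v, 'a) path \<Rightarrow> 'k::field) set \<Rightarrow> (('v, 'a) path \<Rightarrow> 'k) set ring" where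
  "bound_quiver_algebra Q I \<equiv> path_algebra Q Quot I"


section \<open>Finitely generated modules over a noncommutative ring\<close>

text \<open>
  The locale \<^locale>\<open>module\<close> of the library requires a commutative ring of scalars.  We keep its
  records, whose inherited fields \<open>mult\<close> and \<open>one\<close> play no role for modules, and its notion of
  \<^const>\<open>submodule\<close>, which does not need commutativity.
\<close>

locale left_module = R?: ring R + M?: abelian_group M
  for R (structure) and M :: "('r, 'm, 'x) module_scheme" (structure) +
  assumes smult_closed:
      "\<lbrakk>a \<in> carrier R; x \<in> carrier M\<rbrakk> \<Longrightarrow> a \<odot>\<^bsub>M\<^esub> x \<in> carrier M"
    and smult_l_distr:
      "\<lbrakk>a \<in> carrier R; b \<in> carrier R; x \<in> carrier M\<rbrakk> \<Longrightarrow>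
        (a \<oplus>\<^bsub>R\<^esub> b) \<odot>\<^bsub>M\<^esub> x = a \<odot>\<^bsub>M\<^esub> x \<oplus>\<^bsub>M\<^esub> b \<odot>\<^bsub>M\<^esub> x"
    and smult_r_distr:
      "\<lbrakk>a \<in> carrier R; x \<in> carrier M; y \<in> carrier M\<rbrakk> \<Longrightarrow>
        a \<odot>\<^bsub>M\<^esub> (x \<oplus>\<^bsub>M\<^esub> y) = a \<odot>\<^bsub>M\<^esub> x \<oplus>\<^bsub>M\<^esub> a \<odot>\<^bsub>M\<^esub> y"
    and smult_assoc1:
      "\<lbrakk>a \<in> carrier R; b \<in> carrier R; x \<in> carrier M\<rbrakk> \<Longrightarrow>
        (a \<otimes>\<^bsub>R\<^esub> b) \<odot>\<^bsub>M\<^esub> x = a \<odot>\<^bsub>M\<^esub> (b \<odot>\<^bsub>M\<^esub> x)"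
    and smult_one: "x \<in> carrier M \<Longrightarrow> \<one>\<^bsub>R\<^esub> \<odot>\<^bsub>M\<^esub> x = x"

definition finitely_generated :: "('r, 'x) ring_scheme \<Rightarrow> ('r, 'm) module \<Rightarrow> bool" where
  "finitely_generated R M \<longleftrightarrow>
    (\<exists>X \<subseteq> carrier M. finite X \<and> (\<forall>N. submodule N R M \<and> X \<subseteq> N \<longrightarrow> N = carrier M))"

definition fg_modules :: "('r, 'x) ring_scheme \<Rightarrow> ('r, 'm) module set" where
  "fg_modules R = {M. left_module R M \<and> finitely_generated R M}"

definition module_hom ::
    "('r, 'x) ring_scheme \<Rightarrow> ('r, 'm) module \<Rightarrow> ('r, 'm) module \<Rightarrow> ('m \<Rightarrow> 'm) set" where
  "module_hom R M N =
    {f \<in> hom (add_monoid M) (add_monoid N).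
       \<forall>a \<in> carrier R. \<forall>x \<in> carrier M. f (a \<odot>\<^bsub>M\<^esub> x) = a \<odot>\<^bsub>N\<^esub> f x}"

definition short_exact ::
    "('r, 'x) ring_scheme \<Rightarrow> ('r, 'm) module \<Rightarrow> ('r, 'm) module \<Rightarrow> ('r, 'm) module \<Rightarrow> bool" where
  "short_exact R L M N \<longleftrightarrow>
    (\<exists>f \<in> module_hom R L M. \<exists>g \<in> module_hom R M N.
       inj_on f (carrier L) \<and> f ` carrier L = a_kernel M N g \<and> g ` carrier M = carrier N)"


section \<open>Grothendieck groups\<close>

definition K0_relations :: "('r, 'x) ring_scheme \<Rightarrow> (('r, 'm) module \<Rightarrow>\<^sub>0 int) set" where
  "K0_relations R =
    {frag_of M - frag_of L - frag_of N | L M N.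
       L \<in> fg_modules R \<and> M \<in> fg_modules R \<and> N \<in> fg_modules R \<and> short_exact R L M N}"

definition K0_subgroup :: "('r, 'x) ring_scheme \<Rightarrow> (('r, 'm) module \<Rightarrow>\<^sub>0 int) set" where
  "K0_subgroup R = generate (free_Abelian_group (fg_modules R)) (K0_relations R)"

text \<open>
  \<open>K\<^sub>0(mod R)\<close>, built from the modules with carrier in the type \<open>'m\<close>; following the library it is
  written multiplicatively.
\<close>

definition K0 :: "('r, 'x) ring_scheme \<Rightarrow> (('r, 'm) module \<Rightarrow>\<^sub>0 int) set monoid" where
  "K0 R = free_Abelian_group (fg_modules R) Mod K0_subgroup R"

definition K0_class ::
    "('r, 'x) ring_scheme \<Rightarrow> ('r, 'm) module \<Rightarrow> (('r, 'm) module \<Rightarrow>\<^sub>0 int) set" where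
  "K0_class R M = K0_subgroup R #>\<^bsub>free_Abelian_group (fg_modules R)\<^esub> frag_of M"


section \<open>Modules over a bound quiver algebra\<close>

text \<open>
  We let \<open>mod \<Lambda>\<close> consist of the modules whose carrier is a subset of the type \<open>nat \<Rightarrow> 'k\<close>: as
  \<open>\<Lambda>\<close> is finite-dimensional, every finitely generated \<open>\<Lambda>\<close>-module is isomorphic to one of these.
\<close>

type_synonym ('v, 'a, 'k) bqa_module = "((('v, 'a) path \<Rightarrow> 'k) set, nat \<Rightarrow> 'k) module"

text \<open>
  The simple module \<open>S\<^sub>(\<^sub>i\<^sub>)\<close> is a copy of \<open>k\<close> on which the class in \<open>kQ/I\<close> of \<open>f\<close> acts as the
  coefficient of \<open>f\<close> at the trivial path at \<open>i\<close>; that coefficient depends only on the class because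
  \<open>I \<subseteq> R\<^sub>Q\<^sup>2\<close>.
\<close>

definition simple_module :: "'v \<Rightarrow> ('v, 'a, 'k::field) bqa_module" where
  "simple_module i =
    \<lparr> carrier = {x. \<forall>j>0. x j = 0},
      monoid.mult = (\<lambda>_ _ _. 0), monoid.one = (\<lambda>_. 0),
      ring.zero = (\<lambda>_. 0), ring.add = (\<lambda>x y j. x j + y j),
      smult = (\<lambda>X x j. (THE c. \<exists>f \<in> X. c = f (i, [])) * x j) \<rparr>"

text \<open>
  The image of \<open>[M]\<close> under the identification of \<open>K\<^sub>0(mod \<Lambda>)\<^sub>\<real>\<close> with \<open>\<real>\<^sup>n\<close>: its coordinates with
  respect to the basis \<open>[S\<^sub>(\<^sub>i\<^sub>)]\<close>.
\<close>

definition K0_vec ::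
    "('v::finite, 'a) pre_digraph \<Rightarrow> (('v, 'a) path \<Rightarrow> 'k::field) set \<Rightarrow>
      ('v, 'a, 'k) bqa_module \<Rightarrow> real ^ 'v" where
  "K0_vec Q I M =
    (let \<Lambda> = bound_quiver_algebra Q I;
         c = (THE c :: 'v \<Rightarrow> int.
                K0_class \<Lambda> M =
                  (\<Otimes>\<^bsub>K0 \<Lambda>\<^esub> i \<in> UNIV. K0_class \<Lambda> (simple_module i) [^]\<^bsub>K0 \<Lambda>\<^esub> c i))
     in \<chi> i. of_int (c i))"


section \<open>TF-equivalence\<close>

text \<open>
  An element of \<open>K\<^sub>0(proj \<Lambda>)\<^sub>\<real>\<close> is identified with the vector \<open>\<theta>\<close> of its coordinates with respect
  to the basis \<open>[P\<^sub>(\<^sub>i\<^sub>)]\<close>.  As \<open>\<langle>[P\<^sub>(\<^sub>i\<^sub>)], [S\<^sub>(\<^sub>j\<^sub>)]\<rangle> = \<delta>\<^sub>i\<^sub>j\<close>, the pairing is the inner product of coordinate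
  vectors.
\<close>

definition pairing ::
    "('v::finite, 'a) pre_digraph \<Rightarrow> (('v, 'a) path \<Rightarrow> 'k::field) set \<Rightarrow>
      real ^ 'v \<Rightarrow> ('v, 'a, 'k) bqa_module \<Rightarrow> real" where
  "pairing Q I \<theta> M = \<theta> \<bullet> K0_vec Q I M"

definition T_bar ::
    "('v::finite, 'a) pre_digraph \<Rightarrow> (('v, 'a) path \<Rightarrow> 'k::field) set \<Rightarrow>
      real ^ 'v \<Rightarrow> ('v, 'a, 'k) bqa_module set" where
  "T_bar Q I \<theta> =
    {M \<in> fg_modules (bound_quiver_algebra Q I).
       \<forall>M' \<in> fg_modules (bound_quiver_algebra Q I).
         (\<exists>g \<in> module_hom (bound_quiver_algebra Q I) M M'. g ` carrier M = carrier M') \<longrightarrow>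
         0 \<le> pairing Q I \<theta> M'}"

definition F_bar ::
    "('v::finite, 'a) pre_digraph \<Rightarrow> (('v, 'a) path \<Rightarrow> 'k::field) set \<Rightarrow>
      real ^ 'v \<Rightarrow> ('v, 'a, 'k) bqa_module set" where
  "F_bar Q I \<theta> =
    {M \<in> fg_modules (bound_quiver_algebra Q I).
       \<forall>N. submodule N (bound_quiver_algebra Q I) M \<longrightarrow>
         pairing Q I \<theta> (M\<lparr>carrier := N\<rparr>) \<le> 0}"

definition TF_class ::
    "('v::finite, 'a) pre_digraph \<Rightarrow> (('v, 'a) path \<Rightarrow> 'k::field) set \<Rightarrow>
      real ^ 'v \<Rightarrow> (real ^ 'v) set" where
  "TF_class Q I \<theta> = {\<eta>. T_bar Q I \<eta> = T_bar Q I \<theta> \<and> F_bar Q I \<eta> = F_bar Q I \<theta>}"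

text \<open>
  Interior and boundary are taken relative to the linear span, in contrast to \<^const>\<open>rel_interior\<close>
  and \<^const>\<open>rel_frontier\<close>, which use the affine hull.
\<close>

definition span_interior :: "'b::real_normed_vector set \<Rightarrow> 'b set" where
  "span_interior X = (top_of_set (span X)) interior_of X"

definition span_boundary :: "'b::real_normed_vector set \<Rightarrow> 'b set" where
  "span_boundary X = closure X - span_interior X"

end

theory Submission
  imports Defs
begin

text \<open>
  Write \<open>[\<theta>]\<close> for the TF-class of \<open>\<theta>\<close>.  The heart of the proof is that \<open>\<theta> + \<zeta> \<in> [\<theta>]\<close> whenever the torsion
  class and the torsion-free class of \<open>\<theta>\<close> are contained in those of \<open>\<zeta>\<close> (\<open>add_in_TF_class\<close>).  One half
  of this is immediate from the linearity of the pairing.  For the other half let \<open>M\<close> be in the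
  torsion class of \<open>\<theta> + \<zeta>\<close> but not in that of \<open>\<theta>\<close>.  Among the factors of \<open>M\<close> take \<open>M'\<close> with
  \<open>\<langle>\<theta>, M'\<rangle>\<close> minimal, hence negative.  By minimality \<open>M'\<close> lies in the torsion-free class of \<open>\<theta>\<close>, thus
  in that of \<open>\<zeta>\<close>, and so \<open>\<langle>\<theta> + \<zeta>, M'\<rangle> < 0\<close>, a contradiction.  The torsion-free classes are treated
  dually, with submodules of maximal value.

  Taking \<open>\<zeta> \<in> [\<theta>]\<close> shows that \<open>[\<theta>]\<close> is a convex cone.  If \<open>\<eta>\<close> is in the closure of \<open>[\<theta>]\<close>, then the
  classes of \<open>\<theta>\<close> are contained in those of \<open>\<eta>\<close>, so \<open>[\<theta>]\<close> contains \<open>\<theta> + \<zeta>\<close> for all \<open>\<zeta> \<in> [\<eta>]\<close>.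
  Consequently the span of \<open>[\<eta>]\<close> is contained in that of \<open>[\<theta>]\<close>.  If the two spans were equal, \<open>\<theta>\<close>
  would be a difference \<open>\<zeta> - \<xi>\<close> of two elements of the cone \<open>[\<eta>]\<close>, and \<open>\<zeta> = \<theta> + \<xi>\<close> would lie in
  \<open>[\<theta>]\<close> as well as in \<open>[\<eta>]\<close>; then \<open>\<eta> \<in> [\<theta>]\<close>.

  The argument uses that the pairing is additive on short exact sequences and takes only finitely
  many values on the submodules and factors of one module.  Both follow once the coordinates of
  \<open>[M]\<close> in the basis of the classes of simple modules are known to exist, to be unique and to be
  the multiplicities of the simple modules in \<open>M\<close> (\<open>K0_vec_eq\<close>).  For existence, the paths applied
  to a finite generating set, taken in the order of decreasing length, span a filtration of \<open>M\<close> with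
  simple factors (\<open>fg_module_induct\<close>).  For uniqueness, the multiplicity at a vertex \<open>i\<close> is
  described intrinsically as the greatest number of steps at which \<open>e\<^sub>i U\<close> can grow along a chain
  of submodules \<open>U\<close> of \<open>M\<close>, a number that is additive on short exact sequences
  (\<open>idem_length_exact\<close>).
\<close>

section \<open>Submodules, homomorphisms and quotients\<close>

context left_module
begin

lemma smult_zero_left: "x \<in> carrier M \<Longrightarrow> \<zero>\<^bsub>R\<^esub> \<odot>\<^bsub>M\<^esub> x = \<zero>\<^bsub>M\<^esub>"
  using smult_l_distr[of "\<zero>\<^bsub>R\<^esub>" "\<zero>\<^bsub>R\<^esub>" x] smult_closed[of "\<zero>\<^bsub>R\<^esub>" x]
  by (metis M.add.r_cancel_one' R.zero_closed R.l_zero)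

lemma smult_zero_right: "a \<in> carrier R \<Longrightarrow> a \<odot>\<^bsub>M\<^esub> \<zero>\<^bsub>M\<^esub> = \<zero>\<^bsub>M\<^esub>"
  using smult_r_distr[of a "\<zero>\<^bsub>M\<^esub>" "\<zero>\<^bsub>M\<^esub>"] smult_closed[of a "\<zero>\<^bsub>M\<^esub>"]
  by (metis M.add.r_cancel_one' M.zero_closed M.l_zero)

lemma smult_minus_one: "x \<in> carrier M \<Longrightarrow> (\<ominus>\<^bsub>R\<^esub> \<one>\<^bsub>R\<^esub>) \<odot>\<^bsub>M\<^esub> x = \<ominus>\<^bsub>M\<^esub> x"
  using smult_l_distr[of "\<ominus>\<^bsub>R\<^esub> \<one>\<^bsub>R\<^esub>" "\<one>\<^bsub>R\<^esub>" x] smult_one smult_zero_left smult_closed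
  by (metis M.minus_equality R.a_inv_closed R.l_neg R.one_closed)

text \<open>
  Negatives are multiples by \<open>-1\<close>, so a submodule is what is closed under linear combinations.
\<close>

lemma submodule_iff:
  "submodule H R M \<longleftrightarrow> H \<subseteq> carrier M \<and> \<zero>\<^bsub>M\<^esub> \<in> H \<and> (\<forall>x\<in>H. \<forall>y\<in>H. x \<oplus>\<^bsub>M\<^esub> y \<in> H) \<and>
    (\<forall>a\<in>carrier R. \<forall>x\<in>H. a \<odot>\<^bsub>M\<^esub> x \<in> H)" (is "?L \<longleftrightarrow> ?R")
proof
  assume ?L
  then interpret submodule H R M .
  show ?R using subset one_closed m_closed smult_closed by auto
next
  assume r: ?R
  have "\<ominus>\<^bsub>M\<^esub> x \<in> H" if "x \<in> H" for x
    using r that smult_minus_one[of x] by (metis R.a_inv_closed R.one_closed subsetD)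
  then show ?L
    using r by unfold_locales (auto simp: a_inv_def)
qed

lemma carrier_submodule: "submodule (carrier M) R M"
  by (auto simp: submodule_iff smult_closed)

lemma zero_submodule: "submodule {\<zero>\<^bsub>M\<^esub>} R M"
  by (auto simp: submodule_iff smult_zero_right)

lemma submodule_minus:
  assumes "submodule H R M" "x \<in> H" shows "\<ominus>\<^bsub>M\<^esub> x \<in> H"
  using assms smult_minus_one[of x] by (metis R.a_inv_closed R.one_closed submodule_iff subsetD)

lemma submodule_diff:
  assumes "submodule H R M" "x \<in> H" "y \<in> H" shows "x \<ominus>\<^bsub>M\<^esub> y \<in> H"
  using assms submodule_minus[of H y] by (auto simp: submodule_iff a_minus_def)

lemma submodule_is_left_module:
  assumes "submodule H R M" shows "left_module R (M\<lparr>carrier := H\<rparr>)"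
proof -
  have "abelian_group (M\<lparr>carrier := H\<rparr>)"
  proof (rule abelian_groupI, goal_cases)
    case (6 x)
    then show ?case
      using assms submodule_minus[OF assms, of x] M.l_neg[of x] by (auto simp: submodule_iff)
  qed (use assms in \<open>auto simp: submodule_iff M.a_ac subset_iff\<close>)
  then show ?thesis
    using assms R.ring_axioms
    by (intro left_module.intro left_module_axioms.intro)
       (auto simp: submodule_iff subset_iff smult_l_distr smult_r_distr smult_assoc1 smult_one)
qed

lemma submodule_restrict_iff:
  assumes "submodule H R M" "N \<subseteq> H"
  shows "submodule N R (M\<lparr>carrier := H\<rparr>) \<longleftrightarrow> submodule N R M"
proof -
  interpret H: left_module R "M\<lparr>carrier := H\<rparr>" by (rule submodule_is_left_module) fact
  show ?thesis using assms by (auto simp: submodule_iff H.submodule_iff)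
qed

end

lemma module_hom_closed: "f \<in> module_hom R M N \<Longrightarrow> x \<in> carrier M \<Longrightarrow> f x \<in> carrier N"
  by (auto simp: module_hom_def hom_def)

lemma module_hom_add:
  "f \<in> module_hom R M N \<Longrightarrow> x \<in> carrier M \<Longrightarrow> y \<in> carrier M \<Longrightarrow> f (x \<oplus>\<^bsub>M\<^esub> y) = f x \<oplus>\<^bsub>N\<^esub> f y"
  by (auto simp: module_hom_def hom_def)

lemma module_hom_smult:
  "f \<in> module_hom R M N \<Longrightarrow> a \<in> carrier R \<Longrightarrow> x \<in> carrier M \<Longrightarrow> f (a \<odot>\<^bsub>M\<^esub> x) = a \<odot>\<^bsub>N\<^esub> f x"
  by (auto simp: module_hom_def)

lemma module_homI:
  assumes "\<And>x. x \<in> carrier M \<Longrightarrow> f x \<in> carrier N"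
    "\<And>x y. x \<in> carrier M \<Longrightarrow> y \<in> carrier M \<Longrightarrow> f (x \<oplus>\<^bsub>M\<^esub> y) = f x \<oplus>\<^bsub>N\<^esub> f y"
    "\<And>a x. a \<in> carrier R \<Longrightarrow> x \<in> carrier M \<Longrightarrow> f (a \<odot>\<^bsub>M\<^esub> x) = a \<odot>\<^bsub>N\<^esub> f x"
  shows "f \<in> module_hom R M N"
  using assms by (auto simp: module_hom_def hom_def)

context
  fixes R :: "('r, 'x) ring_scheme" and M N :: "('r, 'm) module" and f
  assumes M: "left_module R M" and N: "left_module R N" and f: "f \<in> module_hom R M N"
begin

interpretation M: left_module R M by (rule M)
interpretation N: left_module R N by (rule N)

lemma module_hom_zero: "f \<zero>\<^bsub>M\<^esub> = \<zero>\<^bsub>N\<^esub>"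
  using module_hom_smult[OF f, of "\<zero>\<^bsub>R\<^esub>" "\<zero>\<^bsub>M\<^esub>"] module_hom_closed[OF f, of "\<zero>\<^bsub>M\<^esub>"]
  by (simp add: M.smult_zero_left N.smult_zero_left)

lemma module_hom_diff:
  assumes "x \<in> carrier M" "y \<in> carrier M"
  shows "f (x \<ominus>\<^bsub>M\<^esub> y) = f x \<ominus>\<^bsub>N\<^esub> f y"
  using assms module_hom_smult[OF f, of "\<ominus>\<^bsub>R\<^esub> \<one>\<^bsub>R\<^esub>" y] module_hom_closed[OF f]
  by (simp add: a_minus_def module_hom_add[OF f] M.smult_minus_one N.smult_minus_one)

lemma image_submodule:
  assumes "submodule U R M" shows "submodule (f ` U) R N"
  unfolding N.submodule_iff
proof (intro conjI ballI)
  have U: "U \<subseteq> carrier M" using assms by (simp add: M.submodule_iff)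
  show "f ` U \<subseteq> carrier N" using U module_hom_closed[OF f] by auto
  show "\<zero>\<^bsub>N\<^esub> \<in> f ` U"
    using assms module_hom_zero by (metis M.submodule_iff imageI)
  show "x \<oplus>\<^bsub>N\<^esub> y \<in> f ` U" if "x \<in> f ` U" "y \<in> f ` U" for x y
    using that U assms by (auto simp: M.submodule_iff subset_iff module_hom_add[OF f, symmetric])
  show "a \<odot>\<^bsub>N\<^esub> x \<in> f ` U" if "a \<in> carrier R" "x \<in> f ` U" for a x
    using that U assms by (auto simp: M.submodule_iff subset_iff module_hom_smult[OF f, symmetric])
qed

lemma preimage_submodule:
  assumes "submodule V R N" shows "submodule {x \<in> carrier M. f x \<in> V} R M"
  using assms module_hom_zero
  by (auto simp: M.submodule_iff N.submodule_iff module_hom_add[OF f] module_hom_smult[OF f]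
      M.smult_closed)

lemma kernel_submodule: "submodule (a_kernel M N f) R M"
  using preimage_submodule[OF N.zero_submodule] by (simp add: a_kernel_def')

lemma finitely_generated_image:
  assumes "f ` carrier M = carrier N" "finitely_generated R M"
  shows "finitely_generated R N"
proof -
  obtain X where X: "X \<subseteq> carrier M" "finite X"
    and gen: "\<And>U. submodule U R M \<Longrightarrow> X \<subseteq> U \<Longrightarrow> U = carrier M"
    using assms(2) unfolding finitely_generated_def by blast
  have "V = carrier N" if V: "submodule V R N" "f ` X \<subseteq> V" for V
  proof -
    have "{x \<in> carrier M. f x \<in> V} = carrier M"
      using V X(1) by (intro gen preimage_submodule) auto
    then have "f ` carrier M \<subseteq> V" by blast
    then show ?thesis using assms(1) V(1) by (auto simp: N.submodule_iff)
  qed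
  then show ?thesis
    unfolding finitely_generated_def using X module_hom_closed[OF f]
    by (intro exI[of _ "f ` X"]) auto
qed

lemma short_exact_kernel:
  assumes "f ` carrier M = carrier N"
  shows "short_exact R (M\<lparr>carrier := a_kernel M N f\<rparr>) M N"
  unfolding short_exact_def
proof (intro bexI conjI)
  show "f ` carrier M = carrier N" by fact
  show "(\<lambda>x. x) ` carrier (M\<lparr>carrier := a_kernel M N f\<rparr>) = a_kernel M N f" by simp
  show "inj_on (\<lambda>x. x) (carrier (M\<lparr>carrier := a_kernel M N f\<rparr>))" by simp
  show "(\<lambda>x. x) \<in> module_hom R (M\<lparr>carrier := a_kernel M N f\<rparr>) M"
    by (rule module_homI) (auto simp: a_kernel_def')
qed (rule f)

end

definition coset_rep :: "('r, 'm) module \<Rightarrow> 'm set \<Rightarrow> 'm \<Rightarrow> 'm" where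
  "coset_rep M N x = (SOME y. y \<in> carrier M \<and> y \<ominus>\<^bsub>M\<^esub> x \<in> N)"

text \<open>
  The quotient \<open>M/N\<close> with every coset replaced by a chosen element of it.  Cosets themselves would
  change the type of the elements, and with it the class of modules over which stability is tested.
\<close>

definition rep_quotient :: "('r, 'm) module \<Rightarrow> 'm set \<Rightarrow> ('r, 'm) module" where
  "rep_quotient M N =
    \<lparr> carrier = coset_rep M N ` carrier M, monoid.mult = (\<lambda>x y. x), monoid.one = \<zero>\<^bsub>M\<^esub>,
      ring.zero = coset_rep M N \<zero>\<^bsub>M\<^esub>, ring.add = (\<lambda>x y. coset_rep M N (x \<oplus>\<^bsub>M\<^esub> y)),
      smult = (\<lambda>a x. coset_rep M N (a \<odot>\<^bsub>M\<^esub> x)) \<rparr>"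

context
  fixes R :: "('r, 'x) ring_scheme" and M :: "('r, 'm) module" and N
  assumes M: "left_module R M" and N: "submodule N R M"
begin

interpretation left_module R M by (rule M)

lemma submodule_closed: "N \<subseteq> carrier M" "\<zero>\<^bsub>M\<^esub> \<in> N" "x \<in> N \<Longrightarrow> y \<in> N \<Longrightarrow> x \<oplus>\<^bsub>M\<^esub> y \<in> N"
   "a \<in> carrier R \<Longrightarrow> x \<in> N \<Longrightarrow> a \<odot>\<^bsub>M\<^esub> x \<in> N"
  using N by (auto simp: submodule_iff)

lemma coset_rep:
  assumes "x \<in> carrier M"
  shows "coset_rep M N x \<in> carrier M" "coset_rep M N x \<ominus>\<^bsub>M\<^esub> x \<in> N"
proof -
  have "coset_rep M N x \<in> carrier M \<and> coset_rep M N x \<ominus>\<^bsub>M\<^esub> x \<in> N"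
    unfolding coset_rep_def
    by (rule someI[of _ x]) (use assms submodule_closed(2) in \<open>simp add: M.minus_eq M.r_neg\<close>)
  then show "coset_rep M N x \<in> carrier M" "coset_rep M N x \<ominus>\<^bsub>M\<^esub> x \<in> N" by auto
qed

lemma submodule_diff_trans:
  assumes "x \<in> carrier M" "y \<in> carrier M" "z \<in> carrier M" "x \<ominus>\<^bsub>M\<^esub> y \<in> N" "y \<ominus>\<^bsub>M\<^esub> z \<in> N"
  shows "x \<ominus>\<^bsub>M\<^esub> z \<in> N"
proof -
  have "x \<ominus>\<^bsub>M\<^esub> z = (x \<ominus>\<^bsub>M\<^esub> y) \<oplus>\<^bsub>M\<^esub> (y \<ominus>\<^bsub>M\<^esub> z)"
    using assms(1-3) by (simp add: M.minus_eq M.a_assoc M.r_neg1)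
  then show ?thesis using assms submodule_closed(3) by simp
qed

lemma submodule_diff_sym:
  assumes "x \<in> carrier M" "y \<in> carrier M" "x \<ominus>\<^bsub>M\<^esub> y \<in> N"
  shows "y \<ominus>\<^bsub>M\<^esub> x \<in> N"
proof -
  have "y \<ominus>\<^bsub>M\<^esub> x = \<ominus>\<^bsub>M\<^esub> (x \<ominus>\<^bsub>M\<^esub> y)"
    using assms(1,2) by (simp add: M.minus_eq M.minus_add M.a_comm)
  then show ?thesis using assms submodule_minus[OF N] by simp
qed

lemma coset_rep_eq_iff:
  assumes "x \<in> carrier M" "y \<in> carrier M"
  shows "coset_rep M N x = coset_rep M N y \<longleftrightarrow> x \<ominus>\<^bsub>M\<^esub> y \<in> N"
proof
  assume "coset_rep M N x = coset_rep M N y"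
  then show "x \<ominus>\<^bsub>M\<^esub> y \<in> N"
    using coset_rep[OF assms(1)] coset_rep[OF assms(2)] assms submodule_diff_trans submodule_diff_sym by metis
next
  assume "x \<ominus>\<^bsub>M\<^esub> y \<in> N"
  then have "z \<ominus>\<^bsub>M\<^esub> x \<in> N \<longleftrightarrow> z \<ominus>\<^bsub>M\<^esub> y \<in> N" if "z \<in> carrier M" for z
    using that assms submodule_diff_trans[of z x y] submodule_diff_trans[of z y x] submodule_diff_sym[of x y] by blast
  then show "coset_rep M N x = coset_rep M N y"
    unfolding coset_rep_def by meson
qed

lemma coset_rep_idem: "x \<in> carrier M \<Longrightarrow> coset_rep M N (coset_rep M N x) = coset_rep M N x"
  using coset_rep coset_rep_eq_iff by metis

lemma coset_rep_add:
  assumes "x \<in> carrier M" "y \<in> carrier M"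
  shows "coset_rep M N (coset_rep M N x \<oplus>\<^bsub>M\<^esub> y) = coset_rep M N (x \<oplus>\<^bsub>M\<^esub> y)"
    and "coset_rep M N (y \<oplus>\<^bsub>M\<^esub> coset_rep M N x) = coset_rep M N (y \<oplus>\<^bsub>M\<^esub> x)"
proof -
  have "(coset_rep M N x \<oplus>\<^bsub>M\<^esub> y) \<ominus>\<^bsub>M\<^esub> (x \<oplus>\<^bsub>M\<^esub> y) = coset_rep M N x \<ominus>\<^bsub>M\<^esub> x"
    using assms coset_rep[OF assms(1)] M.a_comm[of "\<ominus>\<^bsub>M\<^esub> x" "\<ominus>\<^bsub>M\<^esub> y"]
    by (simp add: M.minus_eq M.minus_add M.a_assoc M.r_neg2)
  then show "coset_rep M N (coset_rep M N x \<oplus>\<^bsub>M\<^esub> y) = coset_rep M N (x \<oplus>\<^bsub>M\<^esub> y)"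
    using coset_rep[OF assms(1)] assms by (subst coset_rep_eq_iff) auto
  then show "coset_rep M N (y \<oplus>\<^bsub>M\<^esub> coset_rep M N x) = coset_rep M N (y \<oplus>\<^bsub>M\<^esub> x)"
    using assms coset_rep[OF assms(1)] by (simp add: M.a_comm)
qed

lemma coset_rep_smult:
  assumes "a \<in> carrier R" "x \<in> carrier M"
  shows "coset_rep M N (a \<odot>\<^bsub>M\<^esub> coset_rep M N x) = coset_rep M N (a \<odot>\<^bsub>M\<^esub> x)"
proof -
  let ?y = "coset_rep M N x"
  note y = coset_rep[OF assms(2)]
  have "a \<odot>\<^bsub>M\<^esub> (?y \<ominus>\<^bsub>M\<^esub> x) \<oplus>\<^bsub>M\<^esub> a \<odot>\<^bsub>M\<^esub> x = a \<odot>\<^bsub>M\<^esub> ?y"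
    using assms y by (subst smult_r_distr[symmetric]) (auto simp: M.minus_eq M.a_assoc M.l_neg)
  then have "a \<odot>\<^bsub>M\<^esub> ?y \<ominus>\<^bsub>M\<^esub> a \<odot>\<^bsub>M\<^esub> x = a \<odot>\<^bsub>M\<^esub> (?y \<ominus>\<^bsub>M\<^esub> x)"
    using assms y smult_closed
    by (metis M.add.inv_solve_right M.minus_closed M.minus_eq)
  then show ?thesis
    using assms y submodule_closed(4) smult_closed by (subst coset_rep_eq_iff) auto
qed

lemma rep_quotient_left_module: "left_module R (rep_quotient M N)"
proof -
  have inv: "\<exists>y\<in>carrier M. coset_rep M N (x \<oplus>\<^bsub>M\<^esub> y) = coset_rep M N \<zero>\<^bsub>M\<^esub>"
    if "x \<in> carrier M" for x
    using that by (intro bexI[of _ "\<ominus>\<^bsub>M\<^esub> x"]) (auto simp: M.r_neg)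
  have "abelian_group (rep_quotient M N)"
  proof (rule abelian_groupI, goal_cases)
    case (3 x y z)
    then show ?case by (auto simp: rep_quotient_def coset_rep coset_rep_add M.a_assoc)
  qed (auto simp: rep_quotient_def coset_rep coset_rep_add coset_rep_idem M.a_comm inv)
  then show ?thesis
    using R.ring_axioms
    by (intro left_module.intro left_module_axioms.intro;
        (auto simp: rep_quotient_def coset_rep coset_rep_add coset_rep_idem coset_rep_smult
          smult_closed smult_one)?;
        simp add: smult_l_distr smult_r_distr smult_assoc1)
qed

lemma coset_rep_module_hom: "coset_rep M N \<in> module_hom R M (rep_quotient M N)"
  by (rule module_homI)
    (auto simp: rep_quotient_def coset_rep coset_rep_add coset_rep_smult smult_closed)

lemma coset_rep_surj: "coset_rep M N ` carrier M = carrier (rep_quotient M N)"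
  by (simp add: rep_quotient_def)

lemma coset_rep_kernel: "a_kernel M (rep_quotient M N) (coset_rep M N) = N"
proof -
  have "\<ominus>\<^bsub>M\<^esub> \<zero>\<^bsub>M\<^esub> = \<zero>\<^bsub>M\<^esub>" by (metis M.l_zero M.r_neg M.a_inv_closed M.zero_closed)
  note [simp] = this
  show ?thesis
    using submodule_closed(1)
    by (auto simp: a_kernel_def' rep_quotient_def coset_rep_eq_iff M.minus_eq subset_iff)
qed

end

section \<open>The length of the part of a module cut out by an idempotent\<close>

text \<open>
  Chains of submodules \<open>U\<^sub>0 \<subseteq> U\<^sub>1 \<subseteq> \<dots> \<subseteq> U\<close> in which \<open>n\<close> of the steps enlarge \<open>e U\<^sub>j\<close>.
  Over a bound quiver algebra and for \<open>e\<close> the idempotent of a vertex \<open>i\<close>, the largest such \<open>n\<close> is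
  the multiplicity of the simple module \<open>S\<^sub>(\<^sub>i\<^sub>)\<close> in \<open>M\<close>, obtained without bases or dimensions.
  Steps that do not count are admitted so that chains can be pushed forward and pulled back along
  homomorphisms.
\<close>

inductive idem_chain ::
    "('r, 'x) ring_scheme \<Rightarrow> 'r \<Rightarrow> ('r, 'm) module \<Rightarrow> nat \<Rightarrow> 'm set \<Rightarrow> bool"
  for R e M where
    idem_chain_start: "submodule U R M \<Longrightarrow> idem_chain R e M 0 U"
  | idem_chain_enlarge:
      "idem_chain R e M n U \<Longrightarrow> U \<subseteq> V \<Longrightarrow> submodule V R M \<Longrightarrow> idem_chain R e M n V"
  | idem_chain_jump:
      "idem_chain R e M n U \<Longrightarrow> U \<subseteq> V \<Longrightarrow> submodule V R M \<Longrightarrow>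
        x \<in> V \<Longrightarrow> x \<notin> U \<Longrightarrow> e \<odot>\<^bsub>M\<^esub> x = x \<Longrightarrow> idem_chain R e M (Suc n) V"

lemma idem_chain_submodule: "idem_chain R e M n U \<Longrightarrow> submodule U R M"
  by (induction rule: idem_chain.induct) auto

definition idem_lengths :: "('r, 'x) ring_scheme \<Rightarrow> 'r \<Rightarrow> ('r, 'm) module \<Rightarrow> nat set" where
  "idem_lengths R e M = {n. idem_chain R e M n (carrier M)}"

definition idem_length :: "('r, 'x) ring_scheme \<Rightarrow> 'r \<Rightarrow> ('r, 'm) module \<Rightarrow> nat" where
  "idem_length R e M = Max (idem_lengths R e M)"

lemma zero_in_idem_lengths: "left_module R M \<Longrightarrow> 0 \<in> idem_lengths R e M"
  by (simp add: idem_lengths_def idem_chain_start left_module.carrier_submodule)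

locale exact_sequence =
  L: left_module R L + M: left_module R M + N: left_module R N
  for R :: "('r, 'x) ring_scheme" and L M N :: "('r, 'm) module" +
  fixes f g e
  assumes f: "f \<in> module_hom R L M" and g: "g \<in> module_hom R M N"
    and inj: "inj_on f (carrier L)" and exact: "f ` carrier L = a_kernel M N g"
    and surj: "g ` carrier M = carrier N"
    and e: "e \<in> carrier R" and idem: "e \<otimes>\<^bsub>R\<^esub> e = e"
begin

lemma idem_smult: "x \<in> carrier M \<Longrightarrow> e \<odot>\<^bsub>M\<^esub> (e \<odot>\<^bsub>M\<^esub> x) = e \<odot>\<^bsub>M\<^esub> x"
  using M.smult_assoc1[of e e x] e idem by simp

text \<open>
  At a counting step \<open>U \<subset> V\<close> witnessed by \<open>x\<close>, either \<open>g x\<close> is new in \<open>g(V)\<close>, or subtracting an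
  element of \<open>e U\<close> with the same image moves \<open>x\<close> into the kernel, where it witnesses that the
  intersection with \<open>L\<close> grows.
\<close>

lemma idem_chain_split:
  "idem_chain R e M n U \<Longrightarrow>
    \<exists>p q. n = p + q \<and> idem_chain R e L p {z \<in> carrier L. f z \<in> U} \<and> idem_chain R e N q (g ` U)"
proof (induction rule: idem_chain.induct)
  case (idem_chain_start U)
  then show ?case
    by (intro exI[of _ 0])
      (simp add: idem_chain.idem_chain_start image_submodule[OF M.left_module_axioms N.left_module_axioms g]
        preimage_submodule[OF L.left_module_axioms M.left_module_axioms f])
next
  case (idem_chain_enlarge n U V)
  then obtain p q where pq: "n = p + q" "idem_chain R e L p {z \<in> carrier L. f z \<in> U}"
    "idem_chain R e N q (g ` U)" by blast
  have "idem_chain R e L p {z \<in> carrier L. f z \<in> V}" "idem_chain R e N q (g ` V)"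
    using pq idem_chain_enlarge.hyps
    by (auto intro!: idem_chain.idem_chain_enlarge[OF pq(2)] idem_chain.idem_chain_enlarge[OF pq(3)]
        image_submodule[OF M.left_module_axioms N.left_module_axioms g]
        preimage_submodule[OF L.left_module_axioms M.left_module_axioms f])
  then show ?case using pq(1) by blast
next
  case (idem_chain_jump n U V x)
  then obtain p q where pq: "n = p + q" "idem_chain R e L p {z \<in> carrier L. f z \<in> U}"
    "idem_chain R e N q (g ` U)" by blast
  have U: "submodule U R M" by (rule idem_chain_submodule) fact
  have x: "x \<in> carrier M" using idem_chain_jump.hyps by (auto simp: M.submodule_iff)
  have subL: "submodule {z \<in> carrier L. f z \<in> V} R L" and subN: "submodule (g ` V) R N"
    using idem_chain_jump.hyps
    by (auto intro: image_submodule[OF M.left_module_axioms N.left_module_axioms g]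
        preimage_submodule[OF L.left_module_axioms M.left_module_axioms f])
  show ?case
  proof (cases "g x \<in> g ` U")
    case False
    have "e \<odot>\<^bsub>N\<^esub> g x = g x"
      using module_hom_smult[OF g e x] idem_chain_jump.hyps by simp
    then have "idem_chain R e N (Suc q) (g ` V)"
      using False idem_chain_jump.hyps
      by (intro idem_chain.idem_chain_jump[OF pq(3) _ subN, of "g x"]) auto
    moreover have "idem_chain R e L p {z \<in> carrier L. f z \<in> V}"
      using idem_chain_jump.hyps by (intro idem_chain.idem_chain_enlarge[OF pq(2) _ subL]) auto
    ultimately show ?thesis using pq(1) by (metis add_Suc_right)
  next
    case True
    then obtain y' where y': "y' \<in> U" "g y' = g x" by auto
    define y where "y = e \<odot>\<^bsub>M\<^esub> y'"
    have y'c: "y' \<in> carrier M" using y' U by (auto simp: M.submodule_iff)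
    have y: "y \<in> U" "y \<in> carrier M" "g y = g x" "e \<odot>\<^bsub>M\<^esub> y = y"
      using y' y'c U e idem_chain_jump.hyps module_hom_smult[OF g e y'c] module_hom_smult[OF g e x]
      by (auto simp: y_def M.submodule_iff M.smult_closed idem_smult)
    have "g (x \<ominus>\<^bsub>M\<^esub> y) = \<zero>\<^bsub>N\<^esub>"
      using module_hom_diff[OF M.left_module_axioms N.left_module_axioms g x y(2)] y(3)
        module_hom_closed[OF g x] by (simp add: N.M.minus_eq N.M.r_neg)
    then have "x \<ominus>\<^bsub>M\<^esub> y \<in> a_kernel M N g"
      using x y(2) by (auto simp: a_kernel_def')
    then obtain z where z: "z \<in> carrier L" "f z = x \<ominus>\<^bsub>M\<^esub> y"
      unfolding exact[symmetric] by auto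
    have xy: "x = f z \<oplus>\<^bsub>M\<^esub> y"
      using z(2) x y(2) by (simp add: M.M.minus_eq M.M.a_assoc M.M.l_neg)
    have fz: "f z \<in> carrier M" using module_hom_closed[OF f z(1)] .
    have "e \<odot>\<^bsub>M\<^esub> f z \<oplus>\<^bsub>M\<^esub> y = f z \<oplus>\<^bsub>M\<^esub> y"
      using M.smult_r_distr[OF e fz y(2)] y(4) idem_chain_jump.hyps xy by simp
    then have "e \<odot>\<^bsub>M\<^esub> f z = f z"
      using M.smult_closed[OF e fz] fz y(2) by simp
    then have "f (e \<odot>\<^bsub>L\<^esub> z) = f z" using module_hom_smult[OF f e z(1)] by simp
    then have ez: "e \<odot>\<^bsub>L\<^esub> z = z" using inj z(1) L.smult_closed[OF e z(1)] by (auto dest: inj_onD)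
    have "f z \<notin> U" using xy y(1) U idem_chain_jump.hyps by (auto simp: M.submodule_iff)
    moreover have "f z \<in> V"
      unfolding z(2) using idem_chain_jump.hyps y(1) by (intro M.submodule_diff) auto
    ultimately have "idem_chain R e L (Suc p) {z \<in> carrier L. f z \<in> V}"
      using idem_chain_jump.hyps z(1) ez
      by (intro idem_chain.idem_chain_jump[OF pq(2) _ subL, of z]) auto
    moreover have "idem_chain R e N q (g ` V)"
      using idem_chain_jump.hyps by (intro idem_chain.idem_chain_enlarge[OF pq(3) _ subN]) auto
    ultimately show ?thesis using pq(1) by (metis add_Suc)
  qed
qed

text \<open>
  Injectivity of \<open>f\<close> keeps the witness of a counting step outside the smaller submodule.
\<close>

lemma idem_chain_image: "idem_chain R e L p U \<Longrightarrow> idem_chain R e M p (f ` U)"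
proof (induction rule: idem_chain.induct)
  case (idem_chain_start U)
  then show ?case
    by (intro idem_chain.idem_chain_start image_submodule[OF L.left_module_axioms M.left_module_axioms f])
next
  case (idem_chain_enlarge n U V)
  then show ?case
    by (intro idem_chain.idem_chain_enlarge[OF idem_chain_enlarge.IH]
        image_submodule[OF L.left_module_axioms M.left_module_axioms f]) auto
next
  case (idem_chain_jump n U V x)
  have U: "U \<subseteq> carrier L" and V: "V \<subseteq> carrier L"
    using idem_chain_jump.hyps idem_chain_submodule by (auto simp: L.submodule_iff)
  have x: "x \<in> carrier L" using V idem_chain_jump.hyps by auto
  have "f x \<notin> f ` U"
    using inj U x idem_chain_jump.hyps by (auto dest: inj_onD)
  moreover have "e \<odot>\<^bsub>M\<^esub> f x = f x"
    using module_hom_smult[OF f e x] idem_chain_jump.hyps by simp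
  ultimately show ?case
    using idem_chain_jump.hyps
    by (intro idem_chain.idem_chain_jump[OF idem_chain_jump.IH, of _ "f x"]
        image_submodule[OF L.left_module_axioms M.left_module_axioms f]) auto
qed

text \<open>
  The image in \<open>M\<close> of a chain in \<open>L\<close> ends inside the kernel of \<open>g\<close>, hence inside the preimage of
  every submodule of \<open>N\<close>, and can be continued by the preimages of a chain in \<open>N\<close>.  If \<open>y = g x\<close>
  witnesses a counting step in \<open>N\<close>, then \<open>e x\<close> witnesses the step of the preimages.
\<close>

lemma idem_chain_join:
  assumes "idem_chain R e L p (carrier L)"
  shows "idem_chain R e N q V \<Longrightarrow> idem_chain R e M (p + q) {x \<in> carrier M. g x \<in> V}"
proof (induction rule: idem_chain.induct)
  case (idem_chain_start V)
  have "f ` carrier L \<subseteq> {x \<in> carrier M. g x \<in> V}"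
    unfolding exact using idem_chain_start by (auto simp: a_kernel_def' N.submodule_iff)
  then have "idem_chain R e M p {x \<in> carrier M. g x \<in> V}"
    using idem_chain_start
    by (intro idem_chain_enlarge[OF idem_chain_image[OF assms]]
        preimage_submodule[OF M.left_module_axioms N.left_module_axioms g]) auto
  then show ?case by simp
next
  case (idem_chain_enlarge n U V)
  then show ?case
    by (intro idem_chain.idem_chain_enlarge[OF idem_chain_enlarge.IH]
        preimage_submodule[OF M.left_module_axioms N.left_module_axioms g]) auto
next
  case (idem_chain_jump n U V y)
  have "y \<in> carrier N" using idem_chain_jump.hyps by (auto simp: N.submodule_iff)
  then obtain x where x: "x \<in> carrier M" "g x = y" using surj by (metis imageE)
  have "g (e \<odot>\<^bsub>M\<^esub> x) = y"
    using module_hom_smult[OF g e x(1)] x(2) idem_chain_jump.hyps by simp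
  then have "idem_chain R e M (Suc (p + n)) {x \<in> carrier M. g x \<in> V}"
    using idem_chain_jump.hyps x(1) e
    by (intro idem_chain.idem_chain_jump[OF idem_chain_jump.IH, of _ "e \<odot>\<^bsub>M\<^esub> x"]
        preimage_submodule[OF M.left_module_axioms N.left_module_axioms g])
      (auto simp: idem_smult M.smult_closed)
  then show ?case by simp
qed

lemma idem_lengths_exact:
  "idem_lengths R e M = (\<lambda>(p, q). p + q) ` (idem_lengths R e L \<times> idem_lengths R e N)"
proof (intro equalityI subsetI)
  fix n assume "n \<in> idem_lengths R e M"
  then obtain p q where "n = p + q" "idem_chain R e L p {z \<in> carrier L. f z \<in> carrier M}"
    "idem_chain R e N q (g ` carrier M)"
    using idem_chain_split[of n "carrier M"] by (auto simp: idem_lengths_def)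
  moreover have "{z \<in> carrier L. f z \<in> carrier M} = carrier L"
    using module_hom_closed[OF f] by auto
  ultimately show "n \<in> (\<lambda>(p, q). p + q) ` (idem_lengths R e L \<times> idem_lengths R e N)"
    using surj by (auto simp: idem_lengths_def)
next
  fix n assume "n \<in> (\<lambda>(p, q). p + q) ` (idem_lengths R e L \<times> idem_lengths R e N)"
  then obtain p q where n: "n = p + q" and pq: "idem_chain R e L p (carrier L)"
    "idem_chain R e N q (carrier N)"
    by (auto simp: idem_lengths_def)
  have "{x \<in> carrier M. g x \<in> carrier N} = carrier M"
    using module_hom_closed[OF g] by auto
  then show "n \<in> idem_lengths R e M"
    using idem_chain_join[OF pq] n by (simp add: idem_lengths_def)
qed

lemma finite_idem_lengths_exact:
  "finite (idem_lengths R e L) \<Longrightarrow> finite (idem_lengths R e N) \<Longrightarrow> finite (idem_lengths R e M)"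
  unfolding idem_lengths_exact by simp

lemma idem_length_exact:
  assumes "finite (idem_lengths R e L)" "finite (idem_lengths R e N)"
  shows "idem_length R e M = idem_length R e L + idem_length R e N"
  unfolding idem_length_def
proof (rule Max_eqI)
  have ne: "idem_lengths R e L \<noteq> {}" "idem_lengths R e N \<noteq> {}"
    using zero_in_idem_lengths[OF L.left_module_axioms] zero_in_idem_lengths[OF N.left_module_axioms]
    by auto
  show "finite (idem_lengths R e M)" using assms by (rule finite_idem_lengths_exact)
  show "n \<le> Max (idem_lengths R e L) + Max (idem_lengths R e N)" if "n \<in> idem_lengths R e M" for n
    using that assms by (auto simp: idem_lengths_exact intro!: add_mono)
  show "Max (idem_lengths R e L) + Max (idem_lengths R e N) \<in> idem_lengths R e M"
    using Max_in[OF assms(1) ne(1)] Max_in[OF assms(2) ne(2)] by (auto simp: idem_lengths_exact)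
qed

end

lemma short_exact_imp_exact_sequence:
  assumes "short_exact R L M N" "left_module R L" "left_module R M" "left_module R N"
    "e \<in> carrier R" "e \<otimes>\<^bsub>R\<^esub> e = e"
  shows "\<exists>f g. exact_sequence R L M N f g e"
  using assms unfolding short_exact_def
  by (auto simp: exact_sequence_def exact_sequence_axioms_def)

lemma idem_chain_le_1:
  assumes M: "left_module R M"
    and simple: "\<And>U. submodule U R M \<Longrightarrow> U = {\<zero>\<^bsub>M\<^esub>} \<or> U = carrier M"
  shows "idem_chain R e M n U \<Longrightarrow> n \<le> (if U = {\<zero>\<^bsub>M\<^esub>} then 0 else 1)"
proof (induction rule: idem_chain.induct)
  interpret left_module R M by (rule M)
  case (idem_chain_enlarge n U V)
  have "V \<subseteq> carrier M" using idem_chain_enlarge.hyps by (simp add: submodule_iff)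
  then have "U = {\<zero>\<^bsub>M\<^esub>} \<or> V = U"
    using simple[OF idem_chain_submodule[OF idem_chain_enlarge.hyps(1)]] idem_chain_enlarge.hyps(2)
    by blast
  then show ?case using idem_chain_enlarge.IH by (auto split: if_splits)
next
  interpret left_module R M by (rule M)
  case (idem_chain_jump n U V x)
  have "U \<noteq> carrier M" "\<zero>\<^bsub>M\<^esub> \<in> U"
    using idem_chain_submodule[OF idem_chain_jump.hyps(1)] idem_chain_jump.hyps
    by (auto simp: submodule_iff)
  then have "U = {\<zero>\<^bsub>M\<^esub>}" "V \<noteq> {\<zero>\<^bsub>M\<^esub>}"
    using simple[OF idem_chain_submodule[OF idem_chain_jump.hyps(1)]] idem_chain_jump.hyps
    by auto
  then show ?case using idem_chain_jump.IH by simp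
qed auto

text \<open>A step can only count if it adds a nonzero element fixed by \<open>e\<close>.\<close>

lemma idem_lengths_trivial:
  assumes M: "left_module R M" and "\<And>x. x \<in> carrier M \<Longrightarrow> e \<odot>\<^bsub>M\<^esub> x = x \<Longrightarrow> x = \<zero>\<^bsub>M\<^esub>"
  shows "idem_lengths R e M = {0}"
proof -
  interpret left_module R M by (rule M)
  have "idem_chain R e M n U \<Longrightarrow> n = 0" for n U
  proof (induction rule: idem_chain.induct)
    case (idem_chain_jump n U V x)
    then have "x = \<zero>\<^bsub>M\<^esub>" using assms(2) by (auto simp: submodule_iff)
    then show ?case
      using idem_chain_jump idem_chain_submodule[of R e M n U] by (auto simp: submodule_iff)
  qed auto
  then show ?thesis using zero_in_idem_lengths[OF M] by (auto simp: idem_lengths_def)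
qed

section \<open>Scalars and vertex idempotents of a bound quiver algebra\<close>

definition scalar_elt :: "'k::field \<Rightarrow> ('v, 'a) path \<Rightarrow> 'k" where
  "scalar_elt c = (\<lambda>(u, p). if p = [] then c else 0)"

definition path_elt :: "('v, 'a) path \<Rightarrow> ('v, 'a) path \<Rightarrow> 'k::field" where
  "path_elt w = (\<lambda>x. if x = w then 1 else 0)"

lemma path_algebra_simps:
  "f \<in> carrier (path_algebra Q) \<longleftrightarrow> finite {x. f x \<noteq> 0} \<and> {x. f x \<noteq> 0} \<subseteq> quiver_paths Q"
  "(f \<otimes>\<^bsub>path_algebra Q\<^esub> g) (u, p) = (\<Sum>j\<le>length p.
      f (last (pre_digraph.awalk_verts Q u (take j p)), drop j p) * g (u, take j p))"
  "\<zero>\<^bsub>path_algebra Q\<^esub> = (\<lambda>_. 0)"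
  "f \<oplus>\<^bsub>path_algebra Q\<^esub> g = (\<lambda>x. f x + g x)"
  by (auto simp: path_algebra_def)

lemma arrow_ideal_pow_iff:
  "f \<in> arrow_ideal_pow Q m \<longleftrightarrow>
    f \<in> carrier (path_algebra Q) \<and> (\<forall>u p. length p < m \<longrightarrow> f (u, p) = 0)"
  by (auto simp: arrow_ideal_pow_def not_le[symmetric])

lemma mult_scalar_left: "scalar_elt c \<otimes>\<^bsub>path_algebra Q\<^esub> f = (\<lambda>x. c * f x)"
proof
  fix x :: "('a, 'b) path"
  obtain u p where x: "x = (u, p)" by (cases x)
  have "(scalar_elt c \<otimes>\<^bsub>path_algebra Q\<^esub> f) (u, p) =
      (\<Sum>j\<le>length p. if j = length p then c * f (u, p) else 0)"
    unfolding path_algebra_simps by (rule sum.cong) (auto simp: scalar_elt_def)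
  then show "(scalar_elt c \<otimes>\<^bsub>path_algebra Q\<^esub> f) x = c * f x" by (simp add: x)
qed

lemma mult_scalar_right: "f \<otimes>\<^bsub>path_algebra Q\<^esub> scalar_elt c = (\<lambda>x. c * f x)"
proof
  fix x :: "('a, 'b) path"
  obtain u p where x: "x = (u, p)" by (cases x)
  have "(f \<otimes>\<^bsub>path_algebra Q\<^esub> scalar_elt c) (u, p) =
      (\<Sum>j\<le>length p. if j = 0 then c * f (u, p) else 0)"
    unfolding path_algebra_simps
    by (rule sum.cong) (auto simp: scalar_elt_def pre_digraph.awalk_verts.simps)
  then show "(f \<otimes>\<^bsub>path_algebra Q\<^esub> scalar_elt c) x = c * f x" by (simp add: x)
qed

lemma mult_trivial_path:
  "(f \<otimes>\<^bsub>path_algebra Q\<^esub> g) (u, []) = f (u, []) * g (u, [])"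
  by (simp add: path_algebra_simps pre_digraph.awalk_verts.simps)

lemma path_elt_trivial_idem:
  "path_elt (i, []) \<otimes>\<^bsub>path_algebra Q\<^esub> path_elt (i, []) = (path_elt (i, []) :: _ \<Rightarrow> 'k::field)"
proof
  fix x :: "('a, 'b) path"
  obtain u p where x: "x = (u, p)" by (cases x)
  have "((path_elt (i, []) :: _ \<Rightarrow> 'k) \<otimes>\<^bsub>path_algebra Q\<^esub> path_elt (i, [])) (u, p) =
      (\<Sum>j\<le>length p. if j = 0 then path_elt (i, []) (u, p) else 0)"
    unfolding path_algebra_simps
    by (rule sum.cong) (auto simp: path_elt_def pre_digraph.awalk_verts.simps)
  then show "((path_elt (i, []) :: _ \<Rightarrow> 'k) \<otimes>\<^bsub>path_algebra Q\<^esub> path_elt (i, [])) x =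
      path_elt (i, []) x"
    by (simp add: x)
qed

lemma path_elt_closed: "w \<in> quiver_paths Q \<Longrightarrow> path_elt w \<in> carrier (path_algebra Q)"
  by (auto simp: path_algebra_simps path_elt_def)

context bound_quiver
begin

abbreviation kQ :: "(('v, 'a) path \<Rightarrow> 'k) ring" where "kQ \<equiv> path_algebra Q"
abbreviation \<Lambda> :: "(('v, 'a) path \<Rightarrow> 'k) set ring" where "\<Lambda> \<equiv> bound_quiver_algebra Q I"

definition residue :: "(('v, 'a) path \<Rightarrow> 'k) \<Rightarrow> (('v, 'a) path \<Rightarrow> 'k) set" where
  "residue f = I +>\<^bsub>kQ\<^esub> f"

sublocale path_ideal: ideal I "path_algebra Q" by (rule ideal)

lemma residue_hom: "residue \<in> ring_hom kQ \<Lambda>"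
  using path_ideal.rcos_ring_hom unfolding residue_def[abs_def] .

lemma ring_bqa: "ring \<Lambda>" by (rule path_ideal.quotient_is_ring)

lemma residue_closed: "f \<in> carrier kQ \<Longrightarrow> residue f \<in> carrier \<Lambda>"
  using residue_hom by (rule ring_hom_closed)

lemma bqa_cases:
  assumes "a \<in> carrier \<Lambda>" obtains f where "f \<in> carrier kQ" "a = residue f"
  using assms by (auto simp: FactRing_def A_RCOSETS_defs a_r_coset_def residue_def)

lemma residue_mult:
  "f \<in> carrier kQ \<Longrightarrow> g \<in> carrier kQ \<Longrightarrow> residue (f \<otimes>\<^bsub>kQ\<^esub> g) = residue f \<otimes>\<^bsub>\<Lambda>\<^esub> residue g"
  by (rule ring_hom_mult[OF residue_hom])

lemma residue_add:
  "f \<in> carrier kQ \<Longrightarrow> g \<in> carrier kQ \<Longrightarrow> residue (\<lambda>x. f x + g x) = residue f \<oplus>\<^bsub>\<Lambda>\<^esub> residue g"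
  using ring_hom_add[OF residue_hom, of f g] by (simp add: path_algebra_simps)

lemma residue_one: "residue \<one>\<^bsub>kQ\<^esub> = \<one>\<^bsub>\<Lambda>\<^esub>"
  by (rule ring_hom_one[OF residue_hom])

lemma residue_zero: "f \<in> I \<Longrightarrow> residue f = \<zero>\<^bsub>\<Lambda>\<^esub>"
  unfolding residue_def by (simp add: path_ideal.a_rcos_const FactRing_def)

lemma trivial_path: "(u, []) \<in> quiver_paths Q"
  using verts_UNIV by (auto simp: quiver_paths_def awalk_def)

lemma scalar_elt_closed: "scalar_elt c \<in> carrier kQ"
proof -
  have "{x. scalar_elt c x \<noteq> (0::'k)} \<subseteq> (\<lambda>u. (u, [])) ` (UNIV :: 'v set)"
    by (auto simp: scalar_elt_def split: if_splits)
  then show ?thesis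
    using trivial_path by (auto simp: path_algebra_simps intro: finite_subset)
qed

lemma scalar_elt_one: "scalar_elt 1 = \<one>\<^bsub>kQ\<^esub>"
  by (auto simp: scalar_elt_def path_algebra_def verts_UNIV)

lemma cmult_closed: "f \<in> carrier kQ \<Longrightarrow> (\<lambda>x. c * f x) \<in> carrier kQ"
  using path_ideal.m_closed[OF scalar_elt_closed[of c]] by (simp add: mult_scalar_left)

lemma add_closed: "f \<in> carrier kQ \<Longrightarrow> g \<in> carrier kQ \<Longrightarrow> (\<lambda>x. f x + g x) \<in> carrier kQ"
  using path_ideal.a_closed by (simp add: path_algebra_simps(4))

lemma diff_closed: "f \<in> carrier kQ \<Longrightarrow> g \<in> carrier kQ \<Longrightarrow> (\<lambda>x. f x - g x) \<in> carrier kQ"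
  using add_closed[of f "\<lambda>x. (-1) * g x"] cmult_closed[of g "-1"] by simp

lemma finite_paths_of_length: "finite {w \<in> quiver_paths Q. length (snd w) = d}"
proof (rule finite_subset)
  show "{w \<in> quiver_paths Q. length (snd w) = d} \<subseteq>
      UNIV \<times> {p. set p \<subseteq> arcs Q \<and> length p = d}"
    by (auto simp: quiver_paths_def awalk_def)
  show "finite ((UNIV :: 'v set) \<times> {p. set p \<subseteq> arcs Q \<and> length p = d})"
    by (intro finite_cartesian_product finite finite_lists_length_eq finite_arcs)
qed

text \<open>
  Prolonging a path \<open>w\<close> by \<open>f\<close> only leaves the coefficient of \<open>f\<close> at the end of \<open>w\<close>, up to longer
  paths.
\<close>

lemma mult_path_elt:
  assumes f: "f \<in> carrier kQ" and w: "(s, q) \<in> quiver_paths Q"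
  obtains h where "h \<in> arrow_ideal_pow Q (Suc (length q))"
    "f \<otimes>\<^bsub>kQ\<^esub> path_elt (s, q) =
      (\<lambda>x. f (last (awalk_verts s q), []) * path_elt (s, q) x + h x)"
proof
  let ?t = "last (awalk_verts s q)"
  define h where "h = (\<lambda>x. (f \<otimes>\<^bsub>kQ\<^esub> path_elt (s, q)) x - f (?t, []) * path_elt (s, q) x)"
  have p: "path_elt (s, q) \<in> carrier kQ" using w by (rule path_elt_closed)
  have "h \<in> carrier kQ"
    unfolding h_def using f p by (intro diff_closed cmult_closed path_ideal.m_closed)
  moreover have "h (u, p) = 0" if "length p < Suc (length q)" for u p
  proof -
    have "(f \<otimes>\<^bsub>kQ\<^esub> path_elt (s, q)) (u, p) =
        (\<Sum>j\<le>length p. if j = length p then f (?t, []) * path_elt (s, q) (u, p) else 0)"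
      unfolding path_algebra_simps using that by (intro sum.cong) (auto simp: path_elt_def)
    then show ?thesis by (simp add: h_def)
  qed
  ultimately show "h \<in> arrow_ideal_pow Q (Suc (length q))"
    by (simp add: arrow_ideal_pow_iff)
  show "f \<otimes>\<^bsub>kQ\<^esub> path_elt (s, q) = (\<lambda>x. f (?t, []) * path_elt (s, q) x + h x)"
    by (simp add: h_def)
qed

section \<open>The simple modules\<close>

definition vertex_idem :: "'v \<Rightarrow> (('v, 'a) path \<Rightarrow> 'k) set" where
  "vertex_idem i = residue (path_elt (i, []))"

lemma vertex_idem_closed: "vertex_idem i \<in> carrier \<Lambda>"
  unfolding vertex_idem_def by (intro residue_closed path_elt_closed trivial_path)

lemma vertex_idem_idem: "vertex_idem i \<otimes>\<^bsub>\<Lambda>\<^esub> vertex_idem i = vertex_idem i"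
  unfolding vertex_idem_def
  by (subst residue_mult[symmetric]) (auto intro: path_elt_closed trivial_path simp: path_elt_trivial_idem)

text \<open>
  All elements of the ideal are combinations of paths of length at least two, so the coefficient at
  a trivial path is constant on residue classes.
\<close>

lemma residue_trivial_coeff:
  assumes "f \<in> carrier kQ" shows "(THE c. \<exists>g\<in>residue f. c = g (i, [])) = f (i, [])"
proof (rule the_equality)
  show "\<exists>g\<in>residue f. f (i, []) = g (i, [])"
    unfolding residue_def using path_ideal.a_rcos_self[OF assms] by blast
next
  fix c assume "\<exists>g\<in>residue f. c = g (i, [])"
  then obtain h where "h \<in> I" "c = h (i, []) + f (i, [])"
    by (auto simp: residue_def a_r_coset_def r_coset_def path_algebra_simps)
  moreover have "h (i, []) = 0"
    using \<open>h \<in> I\<close> admissible_upper by (auto simp: arrow_ideal_pow_iff)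
  ultimately show "c = f (i, [])" by simp
qed

lemma simple_module_simps:
  "carrier (simple_module i :: ('v, 'a, 'k) bqa_module) = {x. \<forall>j>0. x j = 0}"
  "\<zero>\<^bsub>simple_module i :: ('v, 'a, 'k) bqa_module\<^esub> = (\<lambda>_. 0)"
  "x \<oplus>\<^bsub>simple_module i :: ('v, 'a, 'k) bqa_module\<^esub> y = (\<lambda>j. x j + y j)"
  "f \<in> carrier kQ \<Longrightarrow>
    residue f \<odot>\<^bsub>simple_module i :: ('v, 'a, 'k) bqa_module\<^esub> x = (\<lambda>j. f (i, []) * x j)"
  by (auto simp: simple_module_def residue_trivial_coeff)

lemma simple_left_module: "left_module \<Lambda> (simple_module i :: ('v, 'a, 'k) bqa_module)"
proof -
  let ?S = "simple_module i :: ('v, 'a, 'k) bqa_module"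
  have grp: "abelian_group ?S"
  proof (rule abelian_groupI, goal_cases)
    case (6 x)
    then show ?case
      by (intro bexI[of _ "\<lambda>j. - x j"]) (auto simp: simple_module_simps)
  qed (auto simp: simple_module_simps fun_eq_iff)
  show ?thesis
  proof (intro left_module.intro left_module_axioms.intro grp ring_bqa, goal_cases)
    case (1 a x)
    then show ?case by (auto elim!: bqa_cases simp: simple_module_simps)
  next
    case (2 a b x)
    then show ?case
      by (auto elim!: bqa_cases simp: simple_module_simps residue_add[symmetric] add_closed
          distrib_right)
  next
    case (3 a x y)
    then show ?case by (auto elim!: bqa_cases simp: simple_module_simps distrib_left)
  next
    case (4 a b x)
    then show ?case
      by (auto elim!: bqa_cases simp: simple_module_simps residue_mult[symmetric]
          path_ideal.m_closed mult_trivial_path)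
  next
    case (5 x)
    then show ?case
      by (simp add: residue_one[symmetric] scalar_elt_one[symmetric] simple_module_simps
          scalar_elt_closed) (simp add: scalar_elt_def)
  qed
qed

lemma simple_submodule:
  assumes "submodule U \<Lambda> (simple_module i :: ('v, 'a, 'k) bqa_module)"
  shows "U = {\<lambda>_. 0} \<or> U = {x. \<forall>j>0. x j = 0}"
proof -
  interpret left_module \<Lambda> "simple_module i :: ('v, 'a, 'k) bqa_module" by (rule simple_left_module)
  have U: "x j = 0" if "x \<in> U" "j > 0" for x j
    using assms that unfolding submodule_iff simple_module_simps by blast
  have zero: "(\<lambda>_. 0) \<in> U"
    using assms unfolding submodule_iff simple_module_simps by blast
  have scaled: "(\<lambda>j. c * x j) \<in> U" if "x \<in> U" for c x
  proof -
    have "(\<lambda>j. c * x j) = residue (scalar_elt c) \<odot>\<^bsub>simple_module i :: ('v, 'a, 'k) bqa_module\<^esub> x"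
      by (simp add: simple_module_simps scalar_elt_closed) (simp add: scalar_elt_def)
    then show ?thesis
      using assms that residue_closed[OF scalar_elt_closed[of c]] unfolding submodule_iff by metis
  qed
  show ?thesis
  proof (cases "U \<subseteq> {\<lambda>_. 0}")
    case False
    then obtain x where x: "x \<in> U" "x \<noteq> (\<lambda>_. 0)" by auto
    then have x0: "x 0 \<noteq> 0" using U[OF x(1)] by (auto simp: fun_eq_iff) (metis gr0I)
    have "y \<in> U" if "\<forall>j>0. y j = 0" for y
    proof -
      have "y = (\<lambda>j. (y 0 / x 0) * x j)"
      proof
        fix j show "y j = (y 0 / x 0) * x j"
          using that x0 U[OF x(1), of j] by (cases "j = 0") auto
      qed
      also have "\<dots> \<in> U" by (rule scaled) fact
      finally show ?thesis .
    qed
    then have "U = {x. \<forall>j>0. x j = 0}" using U by blast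
    then show ?thesis ..
  next
    case True
    then have "U = {\<lambda>_. 0}" using zero by blast
    then show ?thesis ..
  qed
qed

lemma simple_finitely_generated:
  "finitely_generated \<Lambda> (simple_module i :: ('v, 'a, 'k) bqa_module)"
  unfolding finitely_generated_def
proof (intro exI[of _ "{\<lambda>j. if j = 0 then 1 else 0}"] conjI allI impI)
  fix U assume U: "submodule U \<Lambda> (simple_module i :: ('v, 'a, 'k) bqa_module) \<and>
    {\<lambda>j. if j = 0 then 1 else 0} \<subseteq> U"
  moreover have "(\<lambda>j::nat. if j = 0 then 1 else 0) \<noteq> (\<lambda>_. 0 :: 'k)"
    by (metis zero_neq_one)
  ultimately have "U \<noteq> {\<lambda>_. 0}" by blast
  then show "U = carrier (simple_module i :: ('v, 'a, 'k) bqa_module)"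
    using U simple_submodule[of U i] by (auto simp: simple_module_simps)
qed (auto simp: simple_module_simps)

lemma simple_fg: "simple_module i \<in> fg_modules \<Lambda>"
  by (simp add: fg_modules_def simple_left_module simple_finitely_generated)

lemma vertex_idem_simple:
  "vertex_idem i \<odot>\<^bsub>simple_module j :: ('v, 'a, 'k) bqa_module\<^esub> x = (if i = j then x else (\<lambda>_. 0))"
  by (auto simp: vertex_idem_def simple_module_simps path_elt_closed trivial_path)
     (auto simp: path_elt_def)

lemma idem_lengths_simple:
  "idem_lengths \<Lambda> (vertex_idem i) (simple_module j :: ('v, 'a, 'k) bqa_module) =
    (if i = j then {0, 1} else {0})"
proof (cases "i = j")
  case False
  then show ?thesis
    using idem_lengths_trivial[OF simple_left_module[of j], of "vertex_idem i"]
    by (auto simp: vertex_idem_simple simple_module_simps)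
next
  case True
  let ?S = "simple_module j :: ('v, 'a, 'k) bqa_module"
  let ?one = "(\<lambda>j. if j = 0 then 1 else 0) :: nat \<Rightarrow> 'k"
  interpret left_module \<Lambda> ?S by (rule simple_left_module)
  have "n \<le> 1" if "n \<in> idem_lengths \<Lambda> (vertex_idem i) ?S" for n
    using that idem_chain_le_1[OF simple_left_module[of j], of "vertex_idem i" n "carrier ?S"] simple_submodule[of _ j]
    by (auto simp: idem_lengths_def simple_module_simps split: if_splits)
  moreover have "0 \<in> idem_lengths \<Lambda> (vertex_idem i) ?S"
    by (rule zero_in_idem_lengths) (rule simple_left_module)
  moreover have "idem_chain \<Lambda> (vertex_idem i) ?S (Suc 0) (carrier ?S)"
    by (rule idem_chain_jump[OF idem_chain_start[OF zero_submodule] _ carrier_submodule, of ?one])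
      (auto simp: simple_module_simps vertex_idem_simple True fun_eq_iff)
  ultimately show ?thesis
    using True by (auto simp: idem_lengths_def le_Suc_eq)
qed

end

section \<open>Filtrations with simple factors\<close>

text \<open>
  Generation of a submodule may be tested against the submodules of the ambient module, in which
  all later calculations take place.
\<close>

lemma finitely_generated_submodule_iff:
  fixes M :: "('r, 'm) module"
  assumes M: "left_module R M" and N: "submodule N R M"
  shows "finitely_generated R (M\<lparr>carrier := N\<rparr>) \<longleftrightarrow>
    (\<exists>X\<subseteq>N. finite X \<and> (\<forall>V. submodule V R M \<and> X \<subseteq> V \<longrightarrow> N \<subseteq> V))" (is "?L \<longleftrightarrow> ?R")
proof -
  interpret left_module R M by (rule M)
  have N': "N \<subseteq> carrier M" using N by (simp add: submodule_iff)
  have sub: "submodule V R (M\<lparr>carrier := N\<rparr>) \<longleftrightarrow> submodule V R M" if "V \<subseteq> N" for V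
    using submodule_restrict_iff[OF N that] .
  have sub_carrier: "V \<subseteq> N" if "submodule V R (M\<lparr>carrier := N\<rparr>)" for V
    using that left_module.submodule_iff[OF submodule_is_left_module[OF N]] by simp
  show ?thesis
  proof
    assume ?L
    then obtain X where X: "X \<subseteq> N" "finite X"
      and gen: "\<And>V. submodule V R (M\<lparr>carrier := N\<rparr>) \<Longrightarrow> X \<subseteq> V \<Longrightarrow> V = N"
      unfolding finitely_generated_def by auto
    have "N \<subseteq> V" if V: "submodule V R M" "X \<subseteq> V" for V
    proof -
      have "submodule (V \<inter> N) R M" using V(1) N by (auto simp: submodule_iff)
      then have "V \<inter> N = N" using X V(2) sub[of "V \<inter> N"] gen[of "V \<inter> N"] by auto
      then show ?thesis by auto
    qed
    then show ?R using X by blast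
  next
    assume ?R
    then obtain X where X: "X \<subseteq> N" "finite X" "\<And>V. submodule V R M \<Longrightarrow> X \<subseteq> V \<Longrightarrow> N \<subseteq> V"
      by auto
    have "V = N" if "submodule V R (M\<lparr>carrier := N\<rparr>)" "X \<subseteq> V" for V
      using that sub[of V] sub_carrier[of V] X(3)[of V] by auto
    then show ?L using X(1,2) unfolding finitely_generated_def by auto
  qed
qed

context bound_quiver
begin

definition scal :: "('v, 'a, 'k) bqa_module \<Rightarrow> 'k \<Rightarrow> (nat \<Rightarrow> 'k) \<Rightarrow> (nat \<Rightarrow> 'k)" where
  "scal M c x = residue (scalar_elt c) \<odot>\<^bsub>M\<^esub> x"

definition adjoin :: "('v, 'a, 'k) bqa_module \<Rightarrow> (nat \<Rightarrow> 'k) set \<Rightarrow> (nat \<Rightarrow> 'k) \<Rightarrow> (nat \<Rightarrow> 'k) set" where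
  "adjoin M U y = {u \<oplus>\<^bsub>M\<^esub> scal M c y | u c. u \<in> U}"

lemma adjoinI: "u \<in> U \<Longrightarrow> u \<oplus>\<^bsub>M\<^esub> scal M c y \<in> adjoin M U y"
  by (auto simp: adjoin_def)

lemma adjoinE:
  assumes "x \<in> adjoin M U y" obtains u c where "x = u \<oplus>\<^bsub>M\<^esub> scal M c y" "u \<in> U"
  using assms by (auto simp: adjoin_def)

text \<open>
  The element \<open>y\<close> spans, modulo \<open>U\<close>, a copy of the simple module at \<open>i\<close> unless it lies in \<open>U\<close>.
\<close>

definition simple_modulo ::
    "('v, 'a, 'k) bqa_module \<Rightarrow> (nat \<Rightarrow> 'k) set \<Rightarrow> 'v \<Rightarrow> (nat \<Rightarrow> 'k) \<Rightarrow> bool" where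
  "simple_modulo M U i y \<longleftrightarrow> y \<in> carrier M \<and>
    (\<forall>f\<in>carrier kQ. \<exists>u\<in>U. residue f \<odot>\<^bsub>M\<^esub> y = scal M (f (i, [])) y \<oplus>\<^bsub>M\<^esub> u)"

text \<open>
  Submodules reached from \<open>0\<close> by adjoining one element at a time, each of which spans a simple
  module modulo the previous submodule.  An adjoined element may already be present, so a tower can
  be written down from a list of generators without selecting a basis from it.
\<close>

inductive tower :: "('v, 'a, 'k) bqa_module \<Rightarrow> (nat \<Rightarrow> 'k) set \<Rightarrow> bool" for M where
    tower_zero: "tower M {\<zero>\<^bsub>M\<^esub>}"
  | tower_adjoin: "tower M U \<Longrightarrow> simple_modulo M U i y \<Longrightarrow> tower M (adjoin M U y)"

context
  fixes M :: "('v, 'a, 'k) bqa_module"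
  assumes M: "left_module \<Lambda> M"
begin

interpretation left_module \<Lambda> M by (rule M)

lemma scal_closed: "x \<in> carrier M \<Longrightarrow> scal M c x \<in> carrier M"
  unfolding scal_def by (intro smult_closed residue_closed scalar_elt_closed)

lemma scal_add_left: "x \<in> carrier M \<Longrightarrow> scal M (c + d) x = scal M c x \<oplus>\<^bsub>M\<^esub> scal M d x"
proof -
  have "residue (scalar_elt (c + d)) = residue (\<lambda>x. scalar_elt c x + scalar_elt d x)"
    by (rule arg_cong[where f = residue]) (auto simp: scalar_elt_def fun_eq_iff)
  then show "x \<in> carrier M \<Longrightarrow> scal M (c + d) x = scal M c x \<oplus>\<^bsub>M\<^esub> scal M d x"
    by (simp add: scal_def residue_add scalar_elt_closed smult_l_distr residue_closed)
qed

lemma scal_add_right: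
  "x \<in> carrier M \<Longrightarrow> y \<in> carrier M \<Longrightarrow> scal M c (x \<oplus>\<^bsub>M\<^esub> y) = scal M c x \<oplus>\<^bsub>M\<^esub> scal M c y"
  unfolding scal_def by (intro smult_r_distr residue_closed scalar_elt_closed)

lemma residue_cmult:
  assumes "f \<in> carrier kQ" "x \<in> carrier M"
  shows "residue (\<lambda>x. c * f x) \<odot>\<^bsub>M\<^esub> x = scal M c (residue f \<odot>\<^bsub>M\<^esub> x)"
    "residue f \<odot>\<^bsub>M\<^esub> scal M c x = scal M c (residue f \<odot>\<^bsub>M\<^esub> x)"
proof -
  show "residue (\<lambda>x. c * f x) \<odot>\<^bsub>M\<^esub> x = scal M c (residue f \<odot>\<^bsub>M\<^esub> x)"
    using assms
    by (simp add: scal_def mult_scalar_left[of Q, symmetric] residue_mult scalar_elt_closed smult_assoc1 residue_closed)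
  moreover have "residue (\<lambda>x. c * f x) \<odot>\<^bsub>M\<^esub> x = residue f \<odot>\<^bsub>M\<^esub> scal M c x"
    using assms
    by (simp add: scal_def mult_scalar_right[of Q, symmetric] residue_mult scalar_elt_closed smult_assoc1 residue_closed)
  ultimately show "residue f \<odot>\<^bsub>M\<^esub> scal M c x = scal M c (residue f \<odot>\<^bsub>M\<^esub> x)" by simp
qed

lemma residue_plus:
  assumes "f \<in> carrier kQ" "g \<in> carrier kQ" "x \<in> carrier M"
  shows "residue (\<lambda>x. f x + g x) \<odot>\<^bsub>M\<^esub> x = residue f \<odot>\<^bsub>M\<^esub> x \<oplus>\<^bsub>M\<^esub> residue g \<odot>\<^bsub>M\<^esub> x"
  using assms by (simp add: residue_add smult_l_distr residue_closed)

lemma scal_scal: "x \<in> carrier M \<Longrightarrow> scal M c (scal M d x) = scal M (c * d) x"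
proof -
  have "residue (scalar_elt (c * d)) = residue (\<lambda>x. c * scalar_elt d x)"
    by (rule arg_cong[where f = residue]) (auto simp: scalar_elt_def fun_eq_iff)
  then show "x \<in> carrier M \<Longrightarrow> scal M c (scal M d x) = scal M (c * d) x"
    using residue_cmult(1)[OF scalar_elt_closed] by (simp add: scal_def)
qed

lemma scal_one: "x \<in> carrier M \<Longrightarrow> scal M 1 x = x"
  by (simp add: scal_def scalar_elt_one residue_one smult_one)

lemma scal_zero: "x \<in> carrier M \<Longrightarrow> scal M 0 x = \<zero>\<^bsub>M\<^esub>"
  using scal_add_left[of x 0 0] scal_closed[of x 0] by simp

lemma submodule_scal: "submodule U \<Lambda> M \<Longrightarrow> x \<in> U \<Longrightarrow> scal M c x \<in> U"
  by (auto simp: scal_def submodule_iff residue_closed scalar_elt_closed)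

lemma adjoin_sub:
  assumes "submodule U \<Lambda> M" "y \<in> carrier M"
  shows "U \<subseteq> adjoin M U y" "y \<in> adjoin M U y"
proof
  fix u assume "u \<in> U"
  then have "u \<oplus>\<^bsub>M\<^esub> scal M 0 y = u" using assms by (auto simp: submodule_iff scal_zero)
  then show "u \<in> adjoin M U y" using adjoinI[of u U M 0 y] \<open>u \<in> U\<close> by simp
next
  have "\<zero>\<^bsub>M\<^esub> \<oplus>\<^bsub>M\<^esub> scal M 1 y = y" "\<zero>\<^bsub>M\<^esub> \<in> U"
    using assms by (auto simp: submodule_iff scal_one)
  then show "y \<in> adjoin M U y" using adjoinI[of "\<zero>\<^bsub>M\<^esub>" U M 1 y] by simp
qed

lemma smult_adjoin:
  assumes U: "submodule U \<Lambda> M" and y: "simple_modulo M U i y" and f: "f \<in> carrier kQ" and u: "u \<in> U"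
  shows "\<exists>u'\<in>U. residue f \<odot>\<^bsub>M\<^esub> (u \<oplus>\<^bsub>M\<^esub> scal M c y) = u' \<oplus>\<^bsub>M\<^esub> scal M (f (i, []) * c) y"
proof -
  have yc: "y \<in> carrier M" and uc: "u \<in> carrier M"
    using y U u by (auto simp: simple_modulo_def submodule_iff)
  obtain v where v: "v \<in> U" "residue f \<odot>\<^bsub>M\<^esub> y = scal M (f (i, [])) y \<oplus>\<^bsub>M\<^esub> v"
    using y f by (auto simp: simple_modulo_def)
  have vc: "v \<in> carrier M" using v U by (auto simp: submodule_iff)
  have fu: "residue f \<odot>\<^bsub>M\<^esub> u \<in> U" using U u f by (simp add: submodule_iff residue_closed)
  then have fuc: "residue f \<odot>\<^bsub>M\<^esub> u \<in> carrier M" using U by (auto simp: submodule_iff)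
  have "residue f \<odot>\<^bsub>M\<^esub> (u \<oplus>\<^bsub>M\<^esub> scal M c y) =
      residue f \<odot>\<^bsub>M\<^esub> u \<oplus>\<^bsub>M\<^esub> (scal M (f (i, []) * c) y \<oplus>\<^bsub>M\<^esub> scal M c v)"
    using f yc uc vc v(2)
    by (simp add: smult_r_distr residue_closed scal_closed residue_cmult(2) scal_add_right scal_scal
        mult.commute)
  also have "\<dots> = (residue f \<odot>\<^bsub>M\<^esub> u \<oplus>\<^bsub>M\<^esub> scal M c v) \<oplus>\<^bsub>M\<^esub> scal M (f (i, []) * c) y"
    using fuc yc vc by (simp add: M.a_ac scal_closed)
  finally show ?thesis
    using fu submodule_scal[OF U v(1)] U by (auto simp: submodule_iff)
qed

lemma add_adjoin:
  assumes "u \<in> carrier M" "u' \<in> carrier M" "y \<in> carrier M"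
  shows "(u \<oplus>\<^bsub>M\<^esub> scal M c y) \<oplus>\<^bsub>M\<^esub> (u' \<oplus>\<^bsub>M\<^esub> scal M c' y) = (u \<oplus>\<^bsub>M\<^esub> u') \<oplus>\<^bsub>M\<^esub> scal M (c + c') y"
  using assms by (simp add: scal_add_left scal_closed M.a_ac)

lemma adjoin_submodule:
  assumes U: "submodule U \<Lambda> M" and y: "simple_modulo M U i y"
  shows "submodule (adjoin M U y) \<Lambda> M"
proof -
  have yc: "y \<in> carrier M" using y by (simp add: simple_modulo_def)
  have Uc: "U \<subseteq> carrier M" using U by (simp add: submodule_iff)
  have "w \<oplus>\<^bsub>M\<^esub> w' \<in> adjoin M U y" if ww': "w \<in> adjoin M U y" "w' \<in> adjoin M U y" for w w'
  proof -
    obtain u c u' c' where w: "w = u \<oplus>\<^bsub>M\<^esub> scal M c y" "u \<in> U" "w' = u' \<oplus>\<^bsub>M\<^esub> scal M c' y" "u' \<in> U"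
      using ww' by (metis adjoinE)
    then have "w \<oplus>\<^bsub>M\<^esub> w' = (u \<oplus>\<^bsub>M\<^esub> u') \<oplus>\<^bsub>M\<^esub> scal M (c + c') y"
      using Uc yc by (simp add: add_adjoin subset_iff)
    moreover have "u \<oplus>\<^bsub>M\<^esub> u' \<in> U" using w U by (simp add: submodule_iff)
    ultimately show ?thesis using adjoinI by metis
  qed
  moreover have "a \<odot>\<^bsub>M\<^esub> w \<in> adjoin M U y" if aw: "a \<in> carrier \<Lambda>" "w \<in> adjoin M U y" for a w
  proof -
    obtain f where f: "f \<in> carrier kQ" "a = residue f" using aw(1) by (rule bqa_cases)
    obtain u c where w: "w = u \<oplus>\<^bsub>M\<^esub> scal M c y" "u \<in> U" using aw(2) by (rule adjoinE)
    show ?thesis using smult_adjoin[OF U y f(1) w(2), of c] adjoinI unfolding f(2) w(1) by metis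
  qed
  moreover have "adjoin M U y \<subseteq> carrier M"
    using Uc yc by (auto simp: adjoin_def scal_closed)
  moreover have "\<zero>\<^bsub>M\<^esub> \<in> adjoin M U y"
    using adjoin_sub(1)[OF U yc] U by (auto simp: submodule_iff)
  ultimately show ?thesis by (simp add: submodule_iff)
qed

lemma tower_submodule: "tower M U \<Longrightarrow> submodule U \<Lambda> M"
  by (induction rule: tower.induct) (auto intro: zero_submodule adjoin_submodule)

text \<open>
  A submodule not contained in \<open>U\<close> contains an element whose coefficient at \<open>y\<close> is not zero; every
  other element is a multiple of this one, up to an element of \<open>U\<close>.
\<close>

lemma tower_submodule_fg:
  "tower M U \<Longrightarrow> submodule N \<Lambda> M \<Longrightarrow> N \<subseteq> U \<Longrightarrow> finitely_generated \<Lambda> (M\<lparr>carrier := N\<rparr>)"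
proof (induction arbitrary: N rule: tower.induct)
  case tower_zero
  then show ?case
    unfolding finitely_generated_submodule_iff[OF M tower_zero.prems(1)]
    by (intro exI[of _ "{}"]) (auto simp: submodule_iff)
next
  case (tower_adjoin U i y)
  have U: "submodule U \<Lambda> M" by (rule tower_submodule) fact
  then have Uc: "U \<subseteq> carrier M" by (simp add: submodule_iff)
  have yc: "y \<in> carrier M" using tower_adjoin.hyps by (simp add: simple_modulo_def)
  note N = tower_adjoin.prems
  show ?case
  proof (cases "N \<subseteq> U")
    case True
    then show ?thesis using tower_adjoin.IH N by blast
  next
    case False
    then obtain z where zN: "z \<in> N" "z \<notin> U" by blast
    moreover from zN obtain u c where "z = u \<oplus>\<^bsub>M\<^esub> scal M c y" "u \<in> U"
      using N(2) by (blast elim: adjoinE)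
    ultimately have z: "z \<in> N" "z \<notin> U" "z = u \<oplus>\<^bsub>M\<^esub> scal M c y" "u \<in> U" by blast+
    have c: "c \<noteq> 0" using z Uc yc by (auto simp: scal_zero)
    have NU: "submodule (N \<inter> U) \<Lambda> M" using N U by (auto simp: submodule_iff)
    then have "finitely_generated \<Lambda> (M\<lparr>carrier := N \<inter> U\<rparr>)" by (rule tower_adjoin.IH) auto
    then obtain X where X: "X \<subseteq> N \<inter> U" "finite X"
      "\<And>V. submodule V \<Lambda> M \<Longrightarrow> X \<subseteq> V \<Longrightarrow> N \<inter> U \<subseteq> V"
      unfolding finitely_generated_submodule_iff[OF M NU] by auto
    have "n \<in> V" if V: "submodule V \<Lambda> M" "insert z X \<subseteq> V" and n: "n \<in> N" for n V
    proof -
      obtain u' d where n': "n = u' \<oplus>\<^bsub>M\<^esub> scal M d y" "u' \<in> U" using n N(2) by (blast elim: adjoinE)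
      let ?w = "scal M (- (d / c)) z"
      have zc: "z \<in> carrier M" "n \<in> carrier M" "u \<in> carrier M" "u' \<in> carrier M"
        using z n N n' Uc by (auto simp: submodule_iff)
      have "?w = scal M (- (d / c)) u \<oplus>\<^bsub>M\<^esub> scal M (- d) y"
        unfolding z(3) using zc yc c by (simp add: scal_add_right scal_closed scal_scal)
      then have "n \<oplus>\<^bsub>M\<^esub> ?w = u' \<oplus>\<^bsub>M\<^esub> scal M (- (d / c)) u"
        unfolding n'(1) using zc yc by (simp add: add_adjoin scal_closed scal_zero)
      then have "n \<oplus>\<^bsub>M\<^esub> ?w \<in> U"
        using n'(2) submodule_scal[OF U z(4)] U by (simp add: submodule_iff)
      moreover have "n \<oplus>\<^bsub>M\<^esub> ?w \<in> N"
        using n submodule_scal[OF N(1) z(1)] N(1) by (simp add: submodule_iff)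
      ultimately have "n \<oplus>\<^bsub>M\<^esub> ?w \<in> V" using X(3) V by auto
      moreover have w: "?w \<in> V" using submodule_scal[OF V(1)] V(2) by auto
      ultimately have "(n \<oplus>\<^bsub>M\<^esub> ?w) \<ominus>\<^bsub>M\<^esub> ?w \<in> V" using V(1) by (intro submodule_diff)
      then show "n \<in> V" using zc by (simp add: M.minus_eq M.a_assoc M.r_neg scal_closed)
    qed
    then show ?thesis
      unfolding finitely_generated_submodule_iff[OF M N(1)] using X(1,2) z(1)
      by (intro exI[of _ "insert z X"]) auto
  qed
qed

lemma tower_extend:
  assumes "finite Y" "tower M U" "\<forall>y\<in>Y. \<exists>i. simple_modulo M U i y"
  shows "\<exists>V. tower M V \<and> U \<subseteq> V \<and> Y \<subseteq> V"
  using assms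
proof (induction Y rule: finite_induct)
  case (insert y Y)
  then obtain V i where V: "tower M V" "U \<subseteq> V" "Y \<subseteq> V" and i: "simple_modulo M U i y" by auto
  have "simple_modulo M V i y" using i V(2) unfolding simple_modulo_def by blast
  then have "tower M (adjoin M V y)" using V(1) by (intro tower_adjoin)
  then show ?case
    using adjoin_sub[OF tower_submodule[OF V(1)], of y] V i
    by (intro exI[of _ "adjoin M V y"]) (auto simp: simple_modulo_def)
qed auto

lemma path_elt_simple_modulo:
  assumes "x \<in> carrier M" "w \<in> quiver_paths Q"
    and U: "\<And>h. h \<in> arrow_ideal_pow Q (Suc (length (snd w))) \<Longrightarrow> residue h \<odot>\<^bsub>M\<^esub> x \<in> U"
  shows "\<exists>i. simple_modulo M U i (residue (path_elt w) \<odot>\<^bsub>M\<^esub> x)"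
proof -
  obtain s q where w: "w = (s, q)" by (cases w)
  have p: "path_elt (s, q) \<in> carrier kQ" using assms w by (auto intro: path_elt_closed)
  have "\<exists>u\<in>U. residue f \<odot>\<^bsub>M\<^esub> (residue (path_elt w) \<odot>\<^bsub>M\<^esub> x) =
      scal M (f (last (awalk_verts s q), [])) (residue (path_elt w) \<odot>\<^bsub>M\<^esub> x) \<oplus>\<^bsub>M\<^esub> u"
    if f: "f \<in> carrier kQ" for f
  proof -
    let ?c = "f (last (awalk_verts s q), [])"
    obtain h where h: "h \<in> arrow_ideal_pow Q (Suc (length q))"
      "f \<otimes>\<^bsub>kQ\<^esub> path_elt (s, q) = (\<lambda>x. ?c * path_elt (s, q) x + h x)"
      using mult_path_elt[OF f] assms(2) w by blast
    have hc: "h \<in> carrier kQ" using h(1) by (simp add: arrow_ideal_pow_iff)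
    have "residue f \<odot>\<^bsub>M\<^esub> (residue (path_elt w) \<odot>\<^bsub>M\<^esub> x) = residue (f \<otimes>\<^bsub>kQ\<^esub> path_elt (s, q)) \<odot>\<^bsub>M\<^esub> x"
      using f p assms(1) by (simp add: w residue_mult smult_assoc1 residue_closed)
    also have "\<dots> = scal M ?c (residue (path_elt w) \<odot>\<^bsub>M\<^esub> x) \<oplus>\<^bsub>M\<^esub> residue h \<odot>\<^bsub>M\<^esub> x"
      unfolding h(2) using p hc assms(1) by (simp add: w residue_plus cmult_closed residue_cmult(1))
    finally show ?thesis using U[of h] h(1) w by auto
  qed
  then show ?thesis
    unfolding simple_modulo_def using assms(1,2)
    by (intro exI[of _ "last (awalk_verts s q)"])
      (auto intro: smult_closed residue_closed path_elt_closed)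
qed

text \<open>
  An element of \<open>R\<^sub>Q\<^sup>d\<close> is a combination of the finitely many paths of length \<open>d\<close> and of an element
  of \<open>R\<^sub>Q\<^sup>d\<^sup>+\<^sup>1\<close>.
\<close>

lemma arrow_ideal_pow_smult:
  assumes x: "x \<in> carrier M" and V: "submodule V \<Lambda> M"
    and paths: "\<And>w. w \<in> quiver_paths Q \<Longrightarrow> length (snd w) = d \<Longrightarrow> residue (path_elt w) \<odot>\<^bsub>M\<^esub> x \<in> V"
    and longer: "\<And>h. h \<in> arrow_ideal_pow Q (Suc d) \<Longrightarrow> residue h \<odot>\<^bsub>M\<^esub> x \<in> V"
  shows "g \<in> arrow_ideal_pow Q d \<Longrightarrow> residue g \<odot>\<^bsub>M\<^esub> x \<in> V"
proof -
  have "residue g \<odot>\<^bsub>M\<^esub> x \<in> V"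
    if "finite W" "W \<subseteq> {w \<in> quiver_paths Q. length (snd w) = d}" "g \<in> arrow_ideal_pow Q d"
      "\<And>w. length (snd w) = d \<Longrightarrow> w \<notin> W \<Longrightarrow> g w = 0" for W g
    using that
  proof (induction W arbitrary: g rule: finite_induct)
    case empty
    then show ?case by (intro longer) (auto simp: arrow_ideal_pow_iff less_Suc_eq)
  next
    case (insert w W)
    define g' where "g' = (\<lambda>x. g x - g w * path_elt w x)"
    have wp: "w \<in> quiver_paths Q" "length (snd w) = d" using insert.prems by auto
    have p: "path_elt w \<in> carrier kQ" using wp(1) by (rule path_elt_closed)
    have gc: "g \<in> carrier kQ" using insert.prems by (simp add: arrow_ideal_pow_iff)
    have g'c: "g' \<in> carrier kQ" unfolding g'_def by (intro diff_closed cmult_closed gc p)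
    have "residue g' \<odot>\<^bsub>M\<^esub> x \<in> V"
    proof (rule insert.IH)
      show "g' \<in> arrow_ideal_pow Q d"
        using insert.prems(2) g'c wp by (auto simp: arrow_ideal_pow_iff g'_def path_elt_def)
      show "g' v = 0" if "length (snd v) = d" "v \<notin> W" for v
        using that insert.prems(3)[of v] by (auto simp: g'_def path_elt_def)
    qed (use insert.prems in auto)
    moreover have "scal M (g w) (residue (path_elt w) \<odot>\<^bsub>M\<^esub> x) \<in> V"
      by (intro submodule_scal[OF V] paths wp)
    moreover have "residue (\<lambda>x. g' x + g w * path_elt w x) \<odot>\<^bsub>M\<^esub> x =
        residue g' \<odot>\<^bsub>M\<^esub> x \<oplus>\<^bsub>M\<^esub> scal M (g w) (residue (path_elt w) \<odot>\<^bsub>M\<^esub> x)"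
      using g'c p x by (simp add: residue_plus cmult_closed residue_cmult(1))
    ultimately show ?case using V by (simp add: submodule_iff g'_def)
  qed
  note combination = this[OF finite_paths_of_length[of d] subset_refl]
  assume g: "g \<in> arrow_ideal_pow Q d"
  then have "{w. g w \<noteq> 0} \<subseteq> quiver_paths Q"
    by (simp add: arrow_ideal_pow_iff path_algebra_simps)
  then show "residue g \<odot>\<^bsub>M\<^esub> x \<in> V" by (intro combination g) blast
qed

text \<open>
  A path of length \<open>d\<close> applied to an element of \<open>X\<close> spans a simple module modulo the longer paths
  applied to it.  So a tower is built by descending from length \<open>m\<close>, where all paths act as zero,
  to length \<open>0\<close>, where the trivial paths recover \<open>X\<close> itself.
\<close>

lemma tower_paths:
  assumes X: "finite X" "X \<subseteq> carrier M" and m: "arrow_ideal_pow Q m \<subseteq> I"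
  shows "d \<le> m \<Longrightarrow> \<exists>U. tower M U \<and> (\<forall>g\<in>arrow_ideal_pow Q d. \<forall>x\<in>X. residue g \<odot>\<^bsub>M\<^esub> x \<in> U)"
proof (induction rule: inc_induct)
  case base
  have "residue g \<odot>\<^bsub>M\<^esub> x = \<zero>\<^bsub>M\<^esub>" if "g \<in> arrow_ideal_pow Q m" "x \<in> X" for g x
    using that m X(2) by (simp add: subset_iff residue_zero smult_zero_left)
  then show ?case using tower_zero by blast
next
  case (step d)
  then obtain U where U: "tower M U"
    "\<And>g x. g \<in> arrow_ideal_pow Q (Suc d) \<Longrightarrow> x \<in> X \<Longrightarrow> residue g \<odot>\<^bsub>M\<^esub> x \<in> U" by blast
  define Y where "Y = (\<lambda>(w, x). residue (path_elt w) \<odot>\<^bsub>M\<^esub> x) `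
    ({w \<in> quiver_paths Q. length (snd w) = d} \<times> X)"
  have "finite Y" unfolding Y_def using X(1) finite_paths_of_length by auto
  moreover have "\<exists>i. simple_modulo M U i y" if "y \<in> Y" for y
    using that U(2) X(2) unfolding Y_def by (auto intro!: path_elt_simple_modulo)
  ultimately obtain V where V: "tower M V" "U \<subseteq> V" "Y \<subseteq> V"
    using tower_extend[of Y U] U(1) by blast
  have "residue g \<odot>\<^bsub>M\<^esub> x \<in> V" if "g \<in> arrow_ideal_pow Q d" "x \<in> X" for g x
  proof (rule arrow_ideal_pow_smult[OF _ tower_submodule[OF V(1)] _ _ that(1)])
    show "x \<in> carrier M" using that X by auto
    show "residue (path_elt w) \<odot>\<^bsub>M\<^esub> x \<in> V" if "w \<in> quiver_paths Q" "length (snd w) = d" for w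
      using that V(3) \<open>x \<in> X\<close> unfolding Y_def by (cases w) (auto simp: image_subset_iff)
    show "residue h \<odot>\<^bsub>M\<^esub> x \<in> V" if "h \<in> arrow_ideal_pow Q (Suc d)" for h
      using U(2)[OF that] V(2) \<open>x \<in> X\<close> by auto
  qed
  then show ?case using V(1) by blast
qed

lemma tower_carrier:
  assumes "finitely_generated \<Lambda> M" shows "tower M (carrier M)"
proof -
  obtain X where X: "X \<subseteq> carrier M" "finite X"
    "\<And>N. submodule N \<Lambda> M \<Longrightarrow> X \<subseteq> N \<Longrightarrow> N = carrier M"
    using assms unfolding finitely_generated_def by blast
  obtain m where "arrow_ideal_pow Q m \<subseteq> I" using admissible_lower by blast
  then obtain U where U: "tower M U"
    "\<And>g x. g \<in> arrow_ideal_pow Q 0 \<Longrightarrow> x \<in> X \<Longrightarrow> residue g \<odot>\<^bsub>M\<^esub> x \<in> U"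
    using tower_paths[OF X(2,1), of m 0] by auto
  have "x \<in> U" if "x \<in> X" for x
  proof -
    have "\<one>\<^bsub>kQ\<^esub> \<in> arrow_ideal_pow Q 0" by (simp add: arrow_ideal_pow_iff path_ideal.one_closed)
    then have "residue \<one>\<^bsub>kQ\<^esub> \<odot>\<^bsub>M\<^esub> x \<in> U" using U(2) that by blast
    then show ?thesis using that X(1) by (auto simp: residue_one smult_one)
  qed
  then have "U = carrier M" using X(3) tower_submodule[OF U(1)] by blast
  then show ?thesis using U(1) by simp
qed

text \<open>
  The quotient map is the coefficient at \<open>y\<close>.  It is well defined because \<open>U\<close> is a
  \<open>k\<close>-subspace without \<open>y\<close>.
\<close>

lemma short_exact_adjoin:
  assumes U: "submodule U \<Lambda> M" and y: "simple_modulo M U i y" and "y \<notin> U"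
  shows "short_exact \<Lambda> (M\<lparr>carrier := U\<rparr>) (M\<lparr>carrier := adjoin M U y\<rparr>) (simple_module i)"
proof -
  let ?V = "adjoin M U y" and ?S = "simple_module i :: ('v, 'a, 'k) bqa_module"
  have yc: "y \<in> carrier M" using y by (simp add: simple_modulo_def)
  have Uc: "U \<subseteq> carrier M" using U by (simp add: submodule_iff)
  have uniq: "c = d" if eq: "u \<oplus>\<^bsub>M\<^esub> scal M c y = u' \<oplus>\<^bsub>M\<^esub> scal M d y" and "u \<in> U" "u' \<in> U" for u u' c d
  proof (rule ccontr)
    assume cd: "c \<noteq> d"
    have uc: "u \<in> carrier M" "u' \<in> carrier M" using that Uc by auto
    have "\<ominus>\<^bsub>M\<^esub> u \<oplus>\<^bsub>M\<^esub> ((u \<oplus>\<^bsub>M\<^esub> scal M c y) \<oplus>\<^bsub>M\<^esub> scal M (- d) y) = scal M (c - d) y"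
      using uc yc scal_add_left[of y c "- d"]
      by (simp add: M.a_assoc[symmetric] scal_closed M.l_neg)
    moreover have "(u' \<oplus>\<^bsub>M\<^esub> scal M d y) \<oplus>\<^bsub>M\<^esub> scal M (- d) y = u'"
      using uc yc scal_add_left[of y d "- d"]
      by (simp add: M.a_assoc scal_closed scal_zero)
    ultimately have "scal M (c - d) y = \<ominus>\<^bsub>M\<^esub> u \<oplus>\<^bsub>M\<^esub> u'" using eq by simp
    then have "scal M (c - d) y \<in> U"
      using submodule_minus[OF U \<open>u \<in> U\<close>] \<open>u' \<in> U\<close> U by (auto simp: submodule_iff)
    then have "scal M (1 / (c - d)) (scal M (c - d) y) \<in> U" by (rule submodule_scal[OF U])
    then show False using cd yc \<open>y \<notin> U\<close> by (simp add: scal_scal scal_one)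
  qed
  \<comment> \<open>the coefficient at \<open>y\<close> of an element of \<open>U + k y\<close>\<close>
  define \<kappa> where "\<kappa> z = (THE c. \<exists>u\<in>U. z = u \<oplus>\<^bsub>M\<^esub> scal M c y)" for z
  have \<kappa>: "\<kappa> (u \<oplus>\<^bsub>M\<^esub> scal M c y) = c" if "u \<in> U" for u c
    unfolding \<kappa>_def using that uniq by blast
  define g :: "(nat \<Rightarrow> 'k) \<Rightarrow> nat \<Rightarrow> 'k" where "g z = (\<lambda>j. if j = 0 then \<kappa> z else 0)" for z
  have "g \<in> module_hom \<Lambda> (M\<lparr>carrier := ?V\<rparr>) ?S"
  proof (rule module_homI)
    fix z assume "z \<in> carrier (M\<lparr>carrier := ?V\<rparr>)"
    then show "g z \<in> carrier ?S" by (simp add: g_def simple_module_simps)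
  next
    fix z z' assume "z \<in> carrier (M\<lparr>carrier := ?V\<rparr>)" "z' \<in> carrier (M\<lparr>carrier := ?V\<rparr>)"
    then obtain u c u' c' where z: "z = u \<oplus>\<^bsub>M\<^esub> scal M c y" "u \<in> U" "z' = u' \<oplus>\<^bsub>M\<^esub> scal M c' y" "u' \<in> U"
      by (auto elim!: adjoinE)
    then have "z \<oplus>\<^bsub>M\<^esub> z' = (u \<oplus>\<^bsub>M\<^esub> u') \<oplus>\<^bsub>M\<^esub> scal M (c + c') y"
      using Uc yc by (simp add: add_adjoin subset_iff)
    moreover have "u \<oplus>\<^bsub>M\<^esub> u' \<in> U" using z U by (simp add: submodule_iff)
    ultimately have "\<kappa> (z \<oplus>\<^bsub>M\<^esub> z') = \<kappa> z + \<kappa> z'" using z \<kappa> by simp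
    then show "g (z \<oplus>\<^bsub>M\<lparr>carrier := ?V\<rparr>\<^esub> z') = g z \<oplus>\<^bsub>?S\<^esub> g z'"
      by (auto simp: g_def simple_module_simps)
  next
    fix a z assume "a \<in> carrier \<Lambda>" "z \<in> carrier (M\<lparr>carrier := ?V\<rparr>)"
    then obtain f u c where f: "f \<in> carrier kQ" "a = residue f"
      and z: "z = u \<oplus>\<^bsub>M\<^esub> scal M c y" "u \<in> U"
      by (auto elim!: adjoinE bqa_cases)
    obtain u' where "u' \<in> U" "a \<odot>\<^bsub>M\<^esub> z = u' \<oplus>\<^bsub>M\<^esub> scal M (f (i, []) * c) y"
      using smult_adjoin[OF U y f(1) z(2), of c] f(2) z(1) by auto
    then have "\<kappa> (a \<odot>\<^bsub>M\<^esub> z) = f (i, []) * \<kappa> z" using z \<kappa> by simp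
    then show "g (a \<odot>\<^bsub>M\<lparr>carrier := ?V\<rparr>\<^esub> z) = a \<odot>\<^bsub>?S\<^esub> g z"
      using f by (auto simp: g_def simple_module_simps)
  qed
  moreover have "(\<lambda>x. x) \<in> module_hom \<Lambda> (M\<lparr>carrier := U\<rparr>) (M\<lparr>carrier := ?V\<rparr>)"
    using adjoin_sub(1)[OF U yc] by (intro module_homI) auto
  moreover have "(\<lambda>x. x) ` carrier (M\<lparr>carrier := U\<rparr>) = a_kernel (M\<lparr>carrier := ?V\<rparr>) ?S g"
  proof -
    have "z \<in> U \<longleftrightarrow> \<kappa> z = 0" if zV: "z \<in> ?V" for z
    proof -
      obtain u c where z: "z = u \<oplus>\<^bsub>M\<^esub> scal M c y" "u \<in> U" using zV by (rule adjoinE)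
      show ?thesis
      proof
        assume "z \<in> U"
        moreover have "z \<oplus>\<^bsub>M\<^esub> scal M 0 y = z" using \<open>z \<in> U\<close> Uc yc by (auto simp: scal_zero)
        ultimately show "\<kappa> z = 0" using \<kappa>[of z 0] by simp
      next
        assume "\<kappa> z = 0"
        then have "c = 0" using z \<kappa> by simp
        then show "z \<in> U" using z Uc yc by (auto simp: scal_zero)
      qed
    qed
    then show ?thesis
      using adjoin_sub(1)[OF U yc]
      by (auto simp: a_kernel_def' g_def simple_module_simps fun_eq_iff split: if_splits)
  qed
  moreover have "g ` carrier (M\<lparr>carrier := ?V\<rparr>) = carrier ?S"
  proof (intro equalityI subsetI)
    fix s :: "nat \<Rightarrow> 'k" assume "s \<in> carrier ?S"
    then have "g (\<zero>\<^bsub>M\<^esub> \<oplus>\<^bsub>M\<^esub> scal M (s 0) y) = s"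
      using \<kappa>[of "\<zero>\<^bsub>M\<^esub>" "s 0"] U by (auto simp: g_def simple_module_simps submodule_iff fun_eq_iff)
    moreover have "\<zero>\<^bsub>M\<^esub> \<oplus>\<^bsub>M\<^esub> scal M (s 0) y \<in> ?V"
      using U by (intro adjoinI) (simp add: submodule_iff)
    ultimately have "s \<in> g ` ?V" by (metis imageI)
    then show "s \<in> g ` carrier (M\<lparr>carrier := ?V\<rparr>)" by simp
  qed (auto simp: g_def simple_module_simps)
  ultimately show ?thesis unfolding short_exact_def by (auto intro!: bexI)
qed

end

lemma fg_submodule:
  fixes M :: "('v, 'a, 'k) bqa_module"
  assumes "M \<in> fg_modules \<Lambda>" "submodule N \<Lambda> M"
  shows "M\<lparr>carrier := N\<rparr> \<in> fg_modules \<Lambda>"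
proof -
  have M: "left_module \<Lambda> M" "finitely_generated \<Lambda> M" using assms by (auto simp: fg_modules_def)
  then interpret left_module \<Lambda> M by simp
  show ?thesis
    using tower_submodule_fg[OF M(1) tower_carrier[OF M] assms(2)] assms(2)
      submodule_is_left_module[OF assms(2)]
    by (auto simp: fg_modules_def submodule_iff)
qed

text \<open>
  Composition series enter the computation of classes and multiplicities as this induction
  principle: every finitely generated module arises from a zero module by finitely many extensions
  by simple modules.
\<close>

lemma fg_module_induct [consumes 1, case_names zero ext]:
  fixes M :: "('v, 'a, 'k) bqa_module"
  assumes "M \<in> fg_modules \<Lambda>"
    and zero: "\<And>Z. Z \<in> fg_modules \<Lambda> \<Longrightarrow> carrier Z = {\<zero>\<^bsub>Z\<^esub>} \<Longrightarrow> P Z"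
    and ext: "\<And>L M i. L \<in> fg_modules \<Lambda> \<Longrightarrow> M \<in> fg_modules \<Lambda> \<Longrightarrow>
      short_exact \<Lambda> L M (simple_module i) \<Longrightarrow> P L \<Longrightarrow> P M"
  shows "P M"
proof -
  have M: "left_module \<Lambda> M" "finitely_generated \<Lambda> M" using assms by (auto simp: fg_modules_def)
  then interpret left_module \<Lambda> M by simp
  have "tower M U \<Longrightarrow> P (M\<lparr>carrier := U\<rparr>)" for U
  proof (induction rule: tower.induct)
    case tower_zero
    show ?case using fg_submodule[OF assms(1) zero_submodule] by (intro zero) auto
  next
    case (tower_adjoin U i y)
    have U: "submodule U \<Lambda> M" by (rule tower_submodule[OF M(1)]) fact
    show ?case
    proof (cases "y \<in> U")
      case True
      have "adjoin M U y \<subseteq> U"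
        using True submodule_scal[OF M(1) U True] U by (auto simp: adjoin_def submodule_iff)
      then have "adjoin M U y = U"
        using adjoin_sub(1)[OF M(1) U, of y] tower_adjoin.hyps by (auto simp: simple_modulo_def)
      then show ?thesis using tower_adjoin.IH by simp
    next
      case False
      show ?thesis
        by (rule ext[OF fg_submodule[OF assms(1) U]
              fg_submodule[OF assms(1) adjoin_submodule[OF M(1) U tower_adjoin.hyps(2)]]
              short_exact_adjoin[OF M(1) U tower_adjoin.hyps(2) False] tower_adjoin.IH])
    qed
  qed
  from this[OF tower_carrier[OF M]] show ?thesis by simp
qed

lemma fg_quotient:
  fixes M :: "('v, 'a, 'k) bqa_module"
  assumes "M \<in> fg_modules \<Lambda>" "submodule N \<Lambda> M"
  shows "rep_quotient M N \<in> fg_modules \<Lambda>"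
proof -
  have M: "left_module \<Lambda> M" "finitely_generated \<Lambda> M" using assms by (auto simp: fg_modules_def)
  show ?thesis
    using finitely_generated_image[OF M(1) rep_quotient_left_module[OF M(1) assms(2)]
        coset_rep_module_hom[OF M(1) assms(2)] coset_rep_surj[OF M(1) assms(2)] M(2)]
      rep_quotient_left_module[OF M(1) assms(2)]
    by (simp add: fg_modules_def)
qed

end

section \<open>Classes in the Grothendieck group\<close>

context bound_quiver
begin

abbreviation \<FF> :: "(('v, 'a, 'k) bqa_module \<Rightarrow>\<^sub>0 int) monoid" where
  "\<FF> \<equiv> free_Abelian_group (fg_modules \<Lambda>)"

abbreviation relations :: "(('v, 'a, 'k) bqa_module \<Rightarrow>\<^sub>0 int) set" where
  "relations \<equiv> K0_subgroup \<Lambda>"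

lemma K0_relations_closed: "K0_relations \<Lambda> \<subseteq> carrier \<FF>"
proof
  fix r :: "('v, 'a, 'k) bqa_module \<Rightarrow>\<^sub>0 int" assume "r \<in> K0_relations \<Lambda>"
  then obtain L M N where r: "r = frag_of M - frag_of L - frag_of N"
    and fg: "L \<in> fg_modules \<Lambda>" "M \<in> fg_modules \<Lambda>" "N \<in> fg_modules \<Lambda>"
    by (auto simp: K0_relations_def)
  have "Poly_Mapping.keys r \<subseteq> {L, M, N}"
    unfolding r using keys_diff[of "frag_of M - frag_of L" "frag_of N"]
      keys_diff[of "frag_of M" "frag_of L"] by auto
  then show "r \<in> carrier \<FF>" using fg by auto
qed

lemma relations_subgroup: "subgroup relations \<FF>"
  unfolding K0_subgroup_def
  by (rule group.generate_is_subgroup[OF group_free_Abelian_group K0_relations_closed])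

lemma relations_normal: "relations \<lhd> \<FF>"
  by (rule comm_group.subgroup_imp_normal[OF abelian_free_Abelian_group relations_subgroup])

lemma relations_add: "x \<in> relations \<Longrightarrow> y \<in> relations \<Longrightarrow> x + y \<in> relations"
  using subgroup.m_closed[OF relations_subgroup, of x y] by simp

lemma relations_uminus: "x \<in> relations \<Longrightarrow> - x \<in> relations"
  using subgroup.m_inv_closed[OF relations_subgroup, of x] subgroup.subset[OF relations_subgroup]
  by (auto simp: subset_iff)

lemma relations_short_exact:
  assumes "L \<in> fg_modules \<Lambda>" "M \<in> fg_modules \<Lambda>" "N \<in> fg_modules \<Lambda>" "short_exact \<Lambda> L M N"
  shows "frag_of M - frag_of L - frag_of N \<in> relations"
  unfolding K0_subgroup_def K0_relations_def using assms by (intro generate.incl) blast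

lemma coset_eq_iff:
  assumes "x \<in> carrier \<FF>" "y \<in> carrier \<FF>"
  shows "relations #>\<^bsub>\<FF>\<^esub> x = relations #>\<^bsub>\<FF>\<^esub> y \<longleftrightarrow> x - y \<in> relations"
proof
  assume "relations #>\<^bsub>\<FF>\<^esub> x = relations #>\<^bsub>\<FF>\<^esub> y"
  then have "x \<in> relations #>\<^bsub>\<FF>\<^esub> y"
    using group.rcos_self[OF group_free_Abelian_group assms(1) relations_subgroup] by simp
  then show "x - y \<in> relations" by (auto simp: r_coset_def)
next
  assume "x - y \<in> relations"
  then have "x \<in> relations #>\<^bsub>\<FF>\<^esub> y"
    unfolding r_coset_def by (auto intro!: bexI[of _ "x - y"])
  then show "relations #>\<^bsub>\<FF>\<^esub> x = relations #>\<^bsub>\<FF>\<^esub> y"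
    using group.repr_independence[OF group_free_Abelian_group _ assms(2) relations_subgroup] by simp
qed

lemma K0_combination:
  assumes "finite J"
  shows "(\<Otimes>\<^bsub>K0 \<Lambda>\<^esub> i \<in> J. K0_class \<Lambda> (simple_module i) [^]\<^bsub>K0 \<Lambda>\<^esub> (c i :: int)) =
    relations #>\<^bsub>\<FF>\<^esub> (\<Sum>i\<in>J. frag_cmul (c i) (frag_of (simple_module i)))"
proof -
  have comm: "comm_group (K0 \<Lambda> :: (('v, 'a, 'k) bqa_module \<Rightarrow>\<^sub>0 int) set monoid)"
    unfolding K0_def
    by (rule comm_group.abelian_FactGroup[OF abelian_free_Abelian_group relations_subgroup])
  then interpret K: comm_group "K0 \<Lambda> :: (('v, 'a, 'k) bqa_module \<Rightarrow>\<^sub>0 int) set monoid" .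
  have hom: "(#>\<^bsub>\<FF>\<^esub>) relations \<in> hom \<FF> (K0 \<Lambda>)"
    unfolding K0_def by (rule normal.r_coset_hom_Mod[OF relations_normal])
  let ?s = "\<lambda>i. frag_of (simple_module i :: ('v, 'a, 'k) bqa_module)"
  have S: "?s i \<in> carrier \<FF>" for i using simple_fg by simp
  have pow: "K0_class \<Lambda> (simple_module i :: ('v, 'a, 'k) bqa_module) [^]\<^bsub>K0 \<Lambda>\<^esub> c i =
      relations #>\<^bsub>\<FF>\<^esub> frag_cmul (c i) (?s i)" for i
    unfolding K0_class_def
    using Group.hom_int_pow[OF hom S group_free_Abelian_group K.group_axioms, of i "c i"]
      int_pow_free_Abelian_group[of "?s i" "fg_modules \<Lambda>" "c i"] simple_fg[of i] by simp
  have cl: "frag_cmul (c i) (?s i) \<in> carrier \<FF>" for i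
    using simple_fg keys_cmul[of "c i" "?s i"] by (auto simp: subset_iff)
  have cosets: "relations #>\<^bsub>\<FF>\<^esub> frag_cmul (c i) (?s i) \<in> carrier (K0 \<Lambda>)" for i
    using hom cl[of i] unfolding hom_def by blast
  show ?thesis
    using assms
  proof (induction J rule: finite_induct)
    case empty
    have "relations #>\<^bsub>\<FF>\<^esub> 0 = \<one>\<^bsub>K0 \<Lambda>\<^esub>"
      using hom_one[OF hom group_free_Abelian_group K.group_axioms] by simp
    then show ?case by simp
  next
    case (insert j J)
    have "(\<Otimes>\<^bsub>K0 \<Lambda>\<^esub> i \<in> insert j J. K0_class \<Lambda> (simple_module i) [^]\<^bsub>K0 \<Lambda>\<^esub> c i) =
        (relations #>\<^bsub>\<FF>\<^esub> frag_cmul (c j) (?s j)) \<otimes>\<^bsub>K0 \<Lambda>\<^esub>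
        (relations #>\<^bsub>\<FF>\<^esub> (\<Sum>i\<in>J. frag_cmul (c i) (?s i)))"
      using insert cosets by (subst K.finprod_insert) (auto simp: pow)
    also have "\<dots> = relations #>\<^bsub>\<FF>\<^esub> (frag_cmul (c j) (?s j) + (\<Sum>i\<in>J. frag_cmul (c i) (?s i)))"
      using hom_mult[OF hom cl sum_closed_free_Abelian_group[of J "\<lambda>i. frag_cmul (c i) (?s i)"]] cl
      by simp
    finally show ?case using insert by simp
  qed
qed

text \<open>
  Coordinates with respect to the classes of the simple modules, as a statement in the free group
  on all modules, where it can be checked by induction and by homomorphisms to the integers.
\<close>

lemma K0_class_combination_iff:
  fixes M :: "('v, 'a, 'k) bqa_module"
  assumes "M \<in> fg_modules \<Lambda>"
  shows "K0_class \<Lambda> M = (\<Otimes>\<^bsub>K0 \<Lambda>\<^esub> i \<in> UNIV. K0_class \<Lambda> (simple_module i) [^]\<^bsub>K0 \<Lambda>\<^esub> (c i :: int)) \<longleftrightarrow>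
    frag_of M - (\<Sum>i\<in>UNIV. frag_cmul (c i) (frag_of (simple_module i))) \<in> relations"
proof -
  have "frag_cmul (c i) (frag_of (simple_module i :: ('v, 'a, 'k) bqa_module)) \<in> carrier \<FF>" for i
    using simple_fg keys_cmul[of "c i" "frag_of (simple_module i :: ('v, 'a, 'k) bqa_module)"]
    by (auto simp: subset_iff)
  then show ?thesis
    unfolding K0_combination[OF finite] unfolding K0_class_def
    using assms by (intro coset_eq_iff sum_closed_free_Abelian_group) auto
qed

definition mult_simple :: "'v \<Rightarrow> ('v, 'a, 'k) bqa_module \<Rightarrow> nat" where
  "mult_simple i M = idem_length \<Lambda> (vertex_idem i) M"

lemma exact_sequence_bqa:
  assumes "L \<in> fg_modules \<Lambda>" "M \<in> fg_modules \<Lambda>" "N \<in> fg_modules \<Lambda>" "short_exact \<Lambda> L M N"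
  obtains f g where "exact_sequence \<Lambda> L M N f g (vertex_idem i)"
proof -
  have "left_module \<Lambda> L" "left_module \<Lambda> M" "left_module \<Lambda> N"
    using assms by (auto simp: fg_modules_def)
  from short_exact_imp_exact_sequence[OF assms(4) this vertex_idem_closed vertex_idem_idem]
  show thesis using that by blast
qed

lemma finite_idem_lengths_fg:
  fixes M :: "('v, 'a, 'k) bqa_module"
  shows "M \<in> fg_modules \<Lambda> \<Longrightarrow> finite (idem_lengths \<Lambda> (vertex_idem i) M)"
proof (induction rule: fg_module_induct)
  case (zero Z)
  then interpret left_module \<Lambda> Z by (simp add: fg_modules_def)
  have "idem_lengths \<Lambda> (vertex_idem i) Z = {0}"
    using zero by (intro idem_lengths_trivial left_module_axioms) auto
  then show ?case by simp
next
  case (ext L M j)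
  obtain f g where "exact_sequence \<Lambda> L M (simple_module j) f g (vertex_idem i)"
    using exact_sequence_bqa[OF ext.hyps(1,2) simple_fg ext.hyps(3), of i] by blast
  from exact_sequence.finite_idem_lengths_exact[OF this ext.IH]
  show ?case by (simp add: idem_lengths_simple)
qed

lemma mult_simple_exact:
  fixes L M N :: "('v, 'a, 'k) bqa_module"
  assumes "L \<in> fg_modules \<Lambda>" "M \<in> fg_modules \<Lambda>" "N \<in> fg_modules \<Lambda>" "short_exact \<Lambda> L M N"
  shows "mult_simple i M = mult_simple i L + mult_simple i N"
proof -
  obtain f g where "exact_sequence \<Lambda> L M N f g (vertex_idem i)"
    using exact_sequence_bqa[OF assms] by blast
  then show ?thesis
    unfolding mult_simple_def using finite_idem_lengths_fg assms
    by (intro exact_sequence.idem_length_exact) auto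
qed

lemma mult_simple_simple: "mult_simple i (simple_module j) = (if i = j then 1 else 0)"
  unfolding mult_simple_def idem_length_def by (simp add: idem_lengths_simple)

text \<open>
  The additive extension of \<open>mult_simple i\<close> to the free group on all modules.  Its values are read
  off in the free group on one point, a copy of the integers.
\<close>

definition mult_hom :: "'v \<Rightarrow> (('v, 'a, 'k) bqa_module \<Rightarrow>\<^sub>0 int) \<Rightarrow> int" where
  "mult_hom i x =
    Poly_Mapping.lookup (frag_extend (\<lambda>M. frag_cmul (int (mult_simple i M)) (frag_of ())) x) ()"

lemma mult_hom_simps:
  "mult_hom i (frag_of M) = int (mult_simple i M)" "mult_hom i 0 = 0"
  "mult_hom i (x + y) = mult_hom i x + mult_hom i y"
  "mult_hom i (x - y) = mult_hom i x - mult_hom i y"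
  "mult_hom i (frag_cmul c x) = c * mult_hom i x"
  "mult_hom i (- x) = - mult_hom i x"
  by (simp_all add: mult_hom_def frag_extend_add frag_extend_diff frag_extend_cmul frag_extend_minus
      lookup_add lookup_minus)

lemma mult_hom_sum: "mult_hom i (sum h J) = (\<Sum>j\<in>J. mult_hom i (h j))"
  by (induction J rule: infinite_finite_induct) (auto simp: mult_hom_simps)

lemma mult_hom_relations: "x \<in> relations \<Longrightarrow> mult_hom i x = 0"
  unfolding K0_subgroup_def
proof (induction rule: generate.induct)
  case (incl h)
  then show ?case by (auto simp: K0_relations_def mult_hom_simps mult_simple_exact)
next
  case (inv h)
  then have "inv\<^bsub>\<FF>\<^esub> h = - h" using K0_relations_closed by auto
  then show ?case using inv by (auto simp: K0_relations_def mult_hom_simps mult_simple_exact)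
qed (auto simp: mult_hom_simps)

text \<open>
  Together with the next lemma this says that the classes of the simple modules form a basis of the
  Grothendieck group; here they are seen to generate it, by adding up composition factors.
\<close>

lemma class_is_combination:
  "M \<in> fg_modules \<Lambda> \<Longrightarrow>
    \<exists>c. frag_of M - (\<Sum>i\<in>UNIV. frag_cmul (c i) (frag_of (simple_module i))) \<in> relations"
proof (induction rule: fg_module_induct)
  case (zero Z)
  have Z: "left_module \<Lambda> Z" using zero by (simp add: fg_modules_def)
  have "short_exact \<Lambda> Z Z Z"
  proof -
    interpret left_module \<Lambda> Z by (rule Z)
    have "(\<lambda>x. x) \<in> module_hom \<Lambda> Z Z" by (rule module_homI) auto
    then show ?thesis
      unfolding short_exact_def using zero(2)
      by (intro bexI[of _ "\<lambda>x. x"]) (auto simp: a_kernel_def')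
  qed
  then have "frag_of Z - frag_of Z - frag_of Z \<in> relations"
    using zero by (intro relations_short_exact)
  then have "frag_of Z \<in> relations" using relations_uminus by force
  then show ?case by (intro exI[of _ "\<lambda>_. 0"]) simp
next
  case (ext L M j)
  then obtain c where c: "frag_of L - (\<Sum>i\<in>UNIV. frag_cmul (c i) (frag_of (simple_module i))) \<in> relations"
    by blast
  let ?s = "\<lambda>i. frag_of (simple_module i :: ('v, 'a, 'k) bqa_module)"
  have "(\<Sum>i\<in>UNIV. frag_cmul (c i + (if i = j then 1 else 0)) (?s i)) =
      (\<Sum>i\<in>UNIV. frag_cmul (c i) (?s i)) + (\<Sum>i\<in>UNIV. if i = j then ?s i else 0)"
    unfolding sum.distrib[symmetric] by (rule sum.cong) (auto simp: frag_cmul_distrib)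
  also have "\<dots> = (\<Sum>i\<in>UNIV. frag_cmul (c i) (?s i)) + ?s j" by simp
  finally have "frag_of M - (\<Sum>i\<in>UNIV. frag_cmul (c i + (if i = j then 1 else 0)) (?s i)) =
      (frag_of M - frag_of L - ?s j) + (frag_of L - (\<Sum>i\<in>UNIV. frag_cmul (c i) (?s i)))"
    by simp
  also have "\<dots> \<in> relations"
    by (intro relations_add c relations_short_exact ext.hyps simple_fg)
  finally show ?case by (intro exI[of _ "\<lambda>i. c i + (if i = j then 1 else 0)"])
qed

text \<open>
  Multiplicities are additive, hence vanish on the relations, and on the simple modules they are
  the Kronecker delta; so they read off the coefficients.
\<close>

lemma combination_unique:
  fixes c :: "'v \<Rightarrow> int"
  assumes "frag_of M - (\<Sum>i\<in>UNIV. frag_cmul (c i) (frag_of (simple_module i))) \<in> relations"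
  shows "c i = int (mult_simple i M)"
  using mult_hom_relations[OF assms, of i]
  by (simp add: mult_hom_simps mult_hom_sum mult_simple_simple if_distrib cong: if_cong)

lemma K0_vec_eq: "M \<in> fg_modules \<Lambda> \<Longrightarrow> K0_vec Q I M = (\<chi> i. real (mult_simple i M))"
proof -
  assume M: "M \<in> fg_modules \<Lambda>"
  obtain c where c: "frag_of M - (\<Sum>i\<in>UNIV. frag_cmul (c i) (frag_of (simple_module i))) \<in> relations"
    using class_is_combination[OF M] by blast
  have "(THE c :: 'v \<Rightarrow> int. K0_class \<Lambda> M =
      (\<Otimes>\<^bsub>K0 \<Lambda>\<^esub> i \<in> UNIV. K0_class \<Lambda> (simple_module i) [^]\<^bsub>K0 \<Lambda>\<^esub> c i)) = (\<lambda>i. int (mult_simple i M))"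
    unfolding K0_class_combination_iff[OF M]
  proof (rule the_equality)
    have "c = (\<lambda>i. int (mult_simple i M))" using combination_unique[OF c] by auto
    then show "frag_of M - (\<Sum>i\<in>UNIV. frag_cmul (int (mult_simple i M)) (frag_of (simple_module i)))
        \<in> relations" using c by simp
  qed (use combination_unique in auto)
  then show ?thesis by (simp add: K0_vec_def)
qed

lemma pairing_eq:
  "M \<in> fg_modules \<Lambda> \<Longrightarrow> pairing Q I \<theta> M = (\<Sum>i\<in>UNIV. \<theta> $ i * real (mult_simple i M))"
  by (simp add: pairing_def K0_vec_eq inner_vec_def)

lemma pairing_exact:
  assumes "L \<in> fg_modules \<Lambda>" "M \<in> fg_modules \<Lambda>" "N \<in> fg_modules \<Lambda>" "short_exact \<Lambda> L M N"
  shows "pairing Q I \<theta> M = pairing Q I \<theta> L + pairing Q I \<theta> N"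
  using assms by (simp add: pairing_eq mult_simple_exact[OF assms] distrib_left sum.distrib)

text \<open>
  Only finitely many dimension vectors lie below a given one, so a stability condition takes
  finitely many values on the submodules, or on the factors, of one module and attains its extrema.
\<close>

lemma finite_pairing_values:
  assumes "\<X> \<subseteq> fg_modules \<Lambda>" and bound: "\<And>X i. X \<in> \<X> \<Longrightarrow> mult_simple i X \<le> b i"
  shows "finite (pairing Q I \<theta> ` \<X>)"
proof (rule finite_subset)
  show "pairing Q I \<theta> ` \<X> \<subseteq>
      (\<lambda>m. \<Sum>i\<in>UNIV. \<theta> $ i * real (m i)) ` (\<Pi>\<^sub>E i\<in>UNIV. {..b i})"
  proof
    fix r assume "r \<in> pairing Q I \<theta> ` \<X>"
    then obtain X where X: "X \<in> \<X>" "r = pairing Q I \<theta> X" by auto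
    then show "r \<in> (\<lambda>m. \<Sum>i\<in>UNIV. \<theta> $ i * real (m i)) ` (\<Pi>\<^sub>E i\<in>UNIV. {..b i})"
      using assms by (intro image_eqI[of _ _ "\<lambda>i. mult_simple i X"]) (auto simp: pairing_eq)
  qed
  show "finite ((\<lambda>m. \<Sum>i\<in>UNIV. \<theta> $ i * real (m i)) ` (\<Pi>\<^sub>E i\<in>UNIV. {..b i}))"
    by (intro finite_imageI finite_PiE) auto
qed

section \<open>TF-classes as convex cones\<close>

lemma short_exact_submodule:
  fixes M :: "('v, 'a, 'k) bqa_module"
  assumes "M \<in> fg_modules \<Lambda>" "submodule N \<Lambda> M"
  shows "short_exact \<Lambda> (M\<lparr>carrier := N\<rparr>) M (rep_quotient M N)"
proof -
  have M: "left_module \<Lambda> M" using assms by (simp add: fg_modules_def)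
  show ?thesis
    using short_exact_kernel[OF M rep_quotient_left_module[OF M assms(2)]
        coset_rep_module_hom[OF M assms(2)] coset_rep_surj[OF M assms(2)]]
    by (simp add: coset_rep_kernel[OF M assms(2)])
qed

lemma pairing_submodule:
  assumes "M \<in> fg_modules \<Lambda>" "submodule N \<Lambda> M"
  shows "pairing Q I \<theta> M = pairing Q I \<theta> (M\<lparr>carrier := N\<rparr>) + pairing Q I \<theta> (rep_quotient M N)"
  using assms by (intro pairing_exact fg_submodule fg_quotient short_exact_submodule)

lemma short_exact_surjection:
  assumes "M \<in> fg_modules \<Lambda>" "M' \<in> fg_modules \<Lambda>" "g \<in> module_hom \<Lambda> M M'" "g ` carrier M = carrier M'"
  shows "submodule (a_kernel M M' g) \<Lambda> M"
    and "short_exact \<Lambda> (M\<lparr>carrier := a_kernel M M' g\<rparr>) M M'"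
  using assms kernel_submodule short_exact_kernel by (auto simp: fg_modules_def)

lemma pairing_add: "pairing Q I (\<theta> + \<zeta>) M = pairing Q I \<theta> M + pairing Q I \<zeta> M"
  by (simp add: pairing_def inner_add_left)

text \<open>
  Among the factors of \<open>M\<close> choose \<open>M'\<close> with \<open>\<langle>\<theta>, M'\<rangle>\<close> minimal.  A submodule of \<open>M'\<close> with a positive
  value would leave a factor with a smaller one, so \<open>M'\<close> lies in the torsion-free class of \<open>\<theta>\<close>,
  and \<open>\<zeta>\<close> cannot make up for a negative value at \<open>M'\<close>.
\<close>

lemma T_bar_add_subset:
  assumes F: "F_bar Q I \<theta> \<subseteq> F_bar Q I \<zeta>"
  shows "T_bar Q I (\<theta> + \<zeta>) \<subseteq> T_bar Q I \<theta>"
proof (rule ccontr)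
  assume "\<not> ?thesis"
  then obtain M where MT: "M \<in> T_bar Q I (\<theta> + \<zeta>)" "M \<notin> T_bar Q I \<theta>" by blast
  then have M: "M \<in> fg_modules \<Lambda>" by (simp add: T_bar_def)
  with MT(2) obtain M0 g0 where M0: "M0 \<in> fg_modules \<Lambda>" "g0 \<in> module_hom \<Lambda> M M0"
    "g0 ` carrier M = carrier M0" "pairing Q I \<theta> M0 < 0"
    by (auto simp: T_bar_def not_le)
  define \<X> where "\<X> = {M' \<in> fg_modules \<Lambda>. \<exists>g \<in> module_hom \<Lambda> M M'. g ` carrier M = carrier M'}"
  have "mult_simple i M' \<le> mult_simple i M" if M': "M' \<in> \<X>" for i M'
  proof -
    obtain g where M': "M' \<in> fg_modules \<Lambda>" "g \<in> module_hom \<Lambda> M M'" "g ` carrier M = carrier M'"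
      using M' by (auto simp: \<X>_def)
    note se = short_exact_surjection[OF M M']
    show ?thesis using mult_simple_exact[OF fg_submodule[OF M se(1)] M M'(1) se(2)] by simp
  qed
  then have fin: "finite (pairing Q I \<theta> ` \<X>)"
    by (intro finite_pairing_values) (auto simp: \<X>_def)
  have "M0 \<in> \<X>" using M0 by (auto simp: \<X>_def)
  then have "Min (pairing Q I \<theta> ` \<X>) \<in> pairing Q I \<theta> ` \<X>" using fin by (intro Min_in) auto
  then obtain M' where "Min (pairing Q I \<theta> ` \<X>) = pairing Q I \<theta> M'" and M'X: "M' \<in> \<X>"
    by (rule imageE)
  then have min: "pairing Q I \<theta> M' \<le> pairing Q I \<theta> X" if "X \<in> \<X>" for X
    using Min_le[OF fin imageI[OF that]] by simp
  obtain g where M': "M' \<in> fg_modules \<Lambda>" and g: "g \<in> module_hom \<Lambda> M M'" "g ` carrier M = carrier M'"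
    using M'X by (auto simp: \<X>_def)
  have lM': "left_module \<Lambda> M'" using M' by (simp add: fg_modules_def)
  have "pairing Q I \<theta> (M'\<lparr>carrier := N\<rparr>) \<le> 0" if N: "submodule N \<Lambda> M'" for N
  proof -
    let ?h = "\<lambda>x. coset_rep M' N (g x)"
    have "?h \<in> module_hom \<Lambda> M (rep_quotient M' N)"
      using g(1) coset_rep_module_hom[OF lM' N]
      by (intro module_homI) (simp_all add: module_hom_closed module_hom_add module_hom_smult)
    moreover have "?h ` carrier M = carrier (rep_quotient M' N)"
      using coset_rep_surj[OF lM' N] g(2) by (metis image_image)
    ultimately have "rep_quotient M' N \<in> \<X>" using fg_quotient[OF M' N] by (auto simp: \<X>_def)
    from min[OF this] show ?thesis using pairing_submodule[OF M' N, of \<theta>] by simp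
  qed
  then have "M' \<in> F_bar Q I \<theta>" using M' by (simp add: F_bar_def)
  then have "M' \<in> F_bar Q I \<zeta>" using F by blast
  then have "pairing Q I \<zeta> (M'\<lparr>carrier := carrier M'\<rparr>) \<le> 0"
    using left_module.carrier_submodule[OF lM'] unfolding F_bar_def by blast
  moreover have "0 \<le> pairing Q I (\<theta> + \<zeta>) M'"
    using MT(1) M' g by (auto simp: T_bar_def)
  moreover have "pairing Q I \<theta> M' < 0" using min[OF \<open>M0 \<in> \<X>\<close>] M0(4) by simp
  ultimately show False by (simp add: pairing_add)
qed

text \<open>
  Dually, a submodule of \<open>M\<close> with maximal value lies in the torsion class of \<open>\<theta>\<close>, since the kernel of
  a map onto a factor with a negative value would have a larger one.
\<close>

lemma F_bar_add_subset:
  assumes T: "T_bar Q I \<theta> \<subseteq> T_bar Q I \<zeta>"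
  shows "F_bar Q I (\<theta> + \<zeta>) \<subseteq> F_bar Q I \<theta>"
proof (rule ccontr)
  assume "\<not> ?thesis"
  then obtain M where MF: "M \<in> F_bar Q I (\<theta> + \<zeta>)" "M \<notin> F_bar Q I \<theta>" by blast
  then have M: "M \<in> fg_modules \<Lambda>" by (simp add: F_bar_def)
  with MF(2) obtain N0 where N0: "submodule N0 \<Lambda> M" "0 < pairing Q I \<theta> (M\<lparr>carrier := N0\<rparr>)"
    by (auto simp: F_bar_def not_le)
  from M interpret left_module \<Lambda> M by (simp add: fg_modules_def)
  define \<X> where "\<X> = {M\<lparr>carrier := N\<rparr> | N. submodule N \<Lambda> M}"
  have "mult_simple i X \<le> mult_simple i M" if "X \<in> \<X>" for i X
    using that mult_simple_exact[OF fg_submodule[OF M] M fg_quotient[OF M] short_exact_submodule[OF M]]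
    by (auto simp: \<X>_def)
  then have fin: "finite (pairing Q I \<theta> ` \<X>)"
    using fg_submodule[OF M] by (intro finite_pairing_values) (auto simp: \<X>_def)
  have N0X: "M\<lparr>carrier := N0\<rparr> \<in> \<X>" using N0 by (auto simp: \<X>_def)
  then have "Max (pairing Q I \<theta> ` \<X>) \<in> pairing Q I \<theta> ` \<X>" using fin by (intro Max_in) auto
  then obtain X where X: "Max (pairing Q I \<theta> ` \<X>) = pairing Q I \<theta> X" "X \<in> \<X>"
    by (rule imageE)
  then obtain N where N: "submodule N \<Lambda> M" and "X = M\<lparr>carrier := N\<rparr>"
    by (auto simp: \<X>_def)
  then have max: "pairing Q I \<theta> Y \<le> pairing Q I \<theta> (M\<lparr>carrier := N\<rparr>)" if "Y \<in> \<X>" for Y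
    using Max_ge[OF fin imageI[OF that]] X(1) by simp
  let ?N = "M\<lparr>carrier := N\<rparr>"
  have fgN: "?N \<in> fg_modules \<Lambda>" by (rule fg_submodule[OF M N])
  have "0 \<le> pairing Q I \<theta> M'" if M': "M' \<in> fg_modules \<Lambda>" "g \<in> module_hom \<Lambda> ?N M'" "g ` carrier ?N = carrier M'"
    for M' g
  proof -
    let ?K = "a_kernel ?N M' g"
    note se = short_exact_surjection[OF fgN M']
    have "?K \<subseteq> N" by (auto simp: a_kernel_def')
    then have "submodule ?K \<Lambda> M" using se(1) submodule_restrict_iff[OF N] by simp
    then have "?N\<lparr>carrier := ?K\<rparr> \<in> \<X>" by (auto simp: \<X>_def)
    from max[OF this] show ?thesis
      using pairing_exact[OF fg_submodule[OF fgN se(1)] fgN M'(1) se(2), of \<theta>] by simp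
  qed
  then have "?N \<in> T_bar Q I \<theta>" using fgN by (auto simp: T_bar_def)
  then have "?N \<in> T_bar Q I \<zeta>" using T by blast
  moreover have "(\<lambda>x. x) \<in> module_hom \<Lambda> ?N ?N" by (rule module_homI) auto
  ultimately have "0 \<le> pairing Q I \<zeta> ?N" using fgN unfolding T_bar_def by force
  moreover have "pairing Q I (\<theta> + \<zeta>) ?N \<le> 0" using MF(1) N by (auto simp: F_bar_def)
  moreover have "0 < pairing Q I \<theta> ?N" using max[OF N0X] N0(2) by simp
  ultimately show False by (simp add: pairing_add)
qed

text \<open>
  A module that \<open>\<theta>\<close> excludes from one of its two classes is excluded by \<open>\<theta> + \<zeta>\<close> too, since on the
  extremal factor or submodule that decides, \<open>\<zeta>\<close> does not have the sign opposite to that of \<open>\<theta>\<close>.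
  For \<open>\<zeta>\<close> in the class of \<open>\<theta>\<close> the lemma makes the class closed under addition; for \<open>\<zeta>\<close> equivalent to
  a point of its closure the class absorbs \<open>\<zeta>\<close>.
\<close>

lemma add_in_TF_class:
  assumes T: "T_bar Q I \<theta> \<subseteq> T_bar Q I \<zeta>" and F: "F_bar Q I \<theta> \<subseteq> F_bar Q I \<zeta>"
  shows "\<theta> + \<zeta> \<in> TF_class Q I \<theta>"
proof -
  have "T_bar Q I \<theta> \<subseteq> T_bar Q I (\<theta> + \<zeta>)"
  proof
    fix M assume M: "M \<in> T_bar Q I \<theta>"
    then have "M \<in> T_bar Q I \<zeta>" using T by blast
    with M show "M \<in> T_bar Q I (\<theta> + \<zeta>)"
      unfolding T_bar_def pairing_add by (blast intro: add_nonneg_nonneg)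
  qed
  moreover have "F_bar Q I \<theta> \<subseteq> F_bar Q I (\<theta> + \<zeta>)"
  proof
    fix M assume M: "M \<in> F_bar Q I \<theta>"
    then have "M \<in> F_bar Q I \<zeta>" using F by blast
    with M show "M \<in> F_bar Q I (\<theta> + \<zeta>)"
      unfolding F_bar_def pairing_add by (blast intro: add_nonpos_nonpos)
  qed
  ultimately show ?thesis
    using T_bar_add_subset[OF F] F_bar_add_subset[OF T] unfolding TF_class_def by blast
qed

lemma TF_class_scaleR:
  assumes "0 < c" "\<zeta> \<in> TF_class Q I \<theta>" shows "c *\<^sub>R \<zeta> \<in> TF_class Q I \<theta>"
proof -
  have "pairing Q I (c *\<^sub>R \<zeta>) M = c * pairing Q I \<zeta> M" for M by (simp add: pairing_def)
  then show ?thesis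
    using assms by (simp add: TF_class_def T_bar_def F_bar_def zero_le_mult_iff mult_le_0_iff)
qed

lemma TF_class_self: "\<theta> \<in> TF_class Q I \<theta>" by (simp add: TF_class_def)

lemma TF_class_eq: "\<zeta> \<in> TF_class Q I \<theta> \<Longrightarrow> TF_class Q I \<zeta> = TF_class Q I \<theta>"
  by (auto simp: TF_class_def)

lemma TF_class_add:
  assumes "\<zeta> \<in> TF_class Q I \<theta>" "\<xi> \<in> TF_class Q I \<theta>" shows "\<zeta> + \<xi> \<in> TF_class Q I \<theta>"
  using add_in_TF_class[of \<zeta> \<xi>] assms by (simp add: TF_class_def)

text \<open>
  Each of the two classes is defined by weak inequalities, which are preserved in the limit.
\<close>

lemma closure_TF_class_subset:
  assumes "\<eta> \<in> closure (TF_class Q I \<theta>)"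
  shows "T_bar Q I \<theta> \<subseteq> T_bar Q I \<eta>" "F_bar Q I \<theta> \<subseteq> F_bar Q I \<eta>"
proof -
  have ge: "0 \<le> pairing Q I \<eta> M" if "\<And>\<zeta>. \<zeta> \<in> TF_class Q I \<theta> \<Longrightarrow> 0 \<le> pairing Q I \<zeta> M" for M
  proof -
    have "closure (TF_class Q I \<theta>) \<subseteq> {\<zeta>. 0 \<le> K0_vec Q I M \<bullet> \<zeta>}"
      using that by (intro closure_minimal closed_Collect_le continuous_intros)
        (auto simp: pairing_def inner_commute)
    then show ?thesis using assms by (auto simp: pairing_def inner_commute)
  qed
  have le: "pairing Q I \<eta> M \<le> 0" if "\<And>\<zeta>. \<zeta> \<in> TF_class Q I \<theta> \<Longrightarrow> pairing Q I \<zeta> M \<le> 0" for M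
  proof -
    have "closure (TF_class Q I \<theta>) \<subseteq> {\<zeta>. K0_vec Q I M \<bullet> \<zeta> \<le> 0}"
      using that by (intro closure_minimal closed_Collect_le continuous_intros)
        (auto simp: pairing_def inner_commute)
    then show ?thesis using assms by (auto simp: pairing_def inner_commute)
  qed
  show "T_bar Q I \<theta> \<subseteq> T_bar Q I \<eta>"
  proof
    fix M assume M: "M \<in> T_bar Q I \<theta>"
    have "0 \<le> pairing Q I \<eta> M'"
      if M': "M' \<in> fg_modules \<Lambda>" "g \<in> module_hom \<Lambda> M M'" "g ` carrier M = carrier M'" for M' g
    proof (rule ge)
      fix \<zeta> assume "\<zeta> \<in> TF_class Q I \<theta>"
      then have "M \<in> T_bar Q I \<zeta>" using M by (simp add: TF_class_def)
      then show "0 \<le> pairing Q I \<zeta> M'" using M' by (auto simp: T_bar_def)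
    qed
    then show "M \<in> T_bar Q I \<eta>" using M by (auto simp: T_bar_def)
  qed
  show "F_bar Q I \<theta> \<subseteq> F_bar Q I \<eta>"
  proof
    fix M assume M: "M \<in> F_bar Q I \<theta>"
    have "pairing Q I \<eta> (M\<lparr>carrier := N\<rparr>) \<le> 0" if N: "submodule N \<Lambda> M" for N
    proof (rule le)
      fix \<zeta> assume "\<zeta> \<in> TF_class Q I \<theta>"
      then have "M \<in> F_bar Q I \<zeta>" using M by (simp add: TF_class_def)
      then show "pairing Q I \<zeta> (M\<lparr>carrier := N\<rparr>) \<le> 0" using N by (auto simp: F_bar_def)
    qed
    then show "M \<in> F_bar Q I \<eta>" using M by (auto simp: F_bar_def)
  qed
qed

end

text \<open>
  The differences of elements of a convex cone form a subspace: a negative factor exchanges the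
  roles of the two elements.
\<close>

lemma span_cone_difference:
  fixes C :: "'b::real_vector set"
  assumes add: "\<And>x y. x \<in> C \<Longrightarrow> y \<in> C \<Longrightarrow> x + y \<in> C"
    and scale: "\<And>c x. 0 < c \<Longrightarrow> x \<in> C \<Longrightarrow> c *\<^sub>R x \<in> C"
    and "C \<noteq> {}" and x: "x \<in> span C"
  obtains z w where "z \<in> C" "w \<in> C" "x = z - w"
proof -
  let ?D = "{z - w | z w. z \<in> C \<and> w \<in> C}"
  obtain e where e: "e \<in> C" using \<open>C \<noteq> {}\<close> by blast
  have "subspace ?D"
    unfolding subspace_def
  proof (intro conjI ballI allI)
    show "0 \<in> ?D" using e by force
    show "x + y \<in> ?D" if "x \<in> ?D" "y \<in> ?D" for x y
    proof -
      obtain z w z' w' where "x = z - w" "y = z' - w'" "z \<in> C" "w \<in> C" "z' \<in> C" "w' \<in> C"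
        using \<open>x \<in> ?D\<close> \<open>y \<in> ?D\<close> by blast
      moreover from this have "x + y = (z + z') - (w + w')" by simp
      ultimately show ?thesis using add by blast
    qed
    show "c *\<^sub>R x \<in> ?D" if "x \<in> ?D" for c x
    proof -
      obtain z w where zw: "x = z - w" "z \<in> C" "w \<in> C" using \<open>x \<in> ?D\<close> by blast
      consider "c = 0" | "0 < c" | "0 < - c" by linarith
      then show ?thesis
      proof cases
        case 1
        then show ?thesis using e by force
      next
        case 2
        have "c *\<^sub>R x = c *\<^sub>R z - c *\<^sub>R w" using zw by (simp add: scaleR_diff_right)
        then show ?thesis using scale[OF 2] zw by blast
      next
        case 3
        have "c *\<^sub>R x = (- c) *\<^sub>R w - (- c) *\<^sub>R z" using zw by (simp add: scaleR_diff_right)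
        then show ?thesis using scale[OF 3] zw by blast
      qed
    qed
  qed
  moreover have "C \<subseteq> ?D"
  proof
    fix y assume "y \<in> C"
    then have "(y + e) - e = y" "y + e \<in> C" using add e by auto
    then show "y \<in> ?D" using e by (metis (mono_tags, lifting) mem_Collect_eq)
  qed
  ultimately have "span C \<subseteq> ?D" by (intro span_minimal)
  then show thesis using x that by blast
qed

theorem proposition1p6:
  fixes Q :: "('v::finite, 'a) pre_digraph"
    and I :: "(('v, 'a) path \<Rightarrow> 'k::alg_closed_field) set"
    and \<theta> \<eta> :: "real ^ 'v"
  assumes "bound_quiver Q I"
    and "\<eta> \<in> span_boundary (TF_class Q I \<theta>) - TF_class Q I \<theta>"
  shows "dim (span (TF_class Q I \<eta>)) < dim (span (TF_class Q I \<theta>))"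
proof -
  interpret bound_quiver Q I by fact
  let ?H = "TF_class Q I \<eta>" and ?T = "TF_class Q I \<theta>"
  have \<eta>: "\<eta> \<in> closure ?T" "\<eta> \<notin> ?T" using assms(2) by (auto simp: span_boundary_def)
  \<comment> \<open>stability for \<open>\<zeta>\<close> is stability for \<open>\<eta>\<close>, which is implied by stability for \<open>\<theta>\<close>\<close>
  have absorb: "\<theta> + \<zeta> \<in> ?T" if "\<zeta> \<in> ?H" for \<zeta>
    using that closure_TF_class_subset[OF \<eta>(1)]
    by (intro add_in_TF_class) (auto simp: TF_class_def)
  have sub: "span ?H \<subseteq> span ?T"
  proof (rule span_minimal)
    show "?H \<subseteq> span ?T"
    proof
      fix \<zeta> assume "\<zeta> \<in> ?H"
      then have "(\<theta> + \<zeta>) - \<theta> \<in> span ?T" by (intro span_diff span_base absorb TF_class_self)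
      then show "\<zeta> \<in> span ?T" by simp
    qed
  qed (rule subspace_span)
  have "span ?H \<noteq> span ?T"
  proof
    assume "span ?H = span ?T"
    then have "\<theta> \<in> span ?H" using span_base[OF TF_class_self] by simp
    then obtain \<zeta> \<xi> where \<zeta>\<xi>: "\<zeta> \<in> ?H" "\<xi> \<in> ?H" "\<theta> = \<zeta> - \<xi>"
      using span_cone_difference[of ?H \<theta>] TF_class_add TF_class_scaleR TF_class_self by blast
    \<comment> \<open>\<open>\<zeta> = \<theta> + \<xi>\<close> lies in both classes, which therefore coincide\<close>
    then have "\<zeta> \<in> ?T" using absorb[of \<xi>] by simp
    then have "?H = ?T" using TF_class_eq \<zeta>\<xi>(1) by metis
    then show False using \<eta>(2) TF_class_self by metis
  qed
  then show ?thesis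
    using subspace_dim_equal[OF subspace_span subspace_span sub] not_le by blast
qed

end
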